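(* \textsc{Sliding Window Temporal Vertex Cover} on always star temporal graphs can be solved in $O(T\Delta(n+m)\cdot 2^{\Delta})$ time, where $n$ and $m$ are the numbers of vertices and edges of the underlying graph, $T$ is the lifetime and $\Delta$ is the window length.
   Context: A temporal graph is a pair $(G,\lambda)$ where $G=(V,E)$ is a finite simple undirected graph and $\lambda:E\to 2^{\mathbb{N}}$ assigns to every edge a finite nonempty set of positive integer time labels, given explicitly; edge $e$ is active at each $t\in\lambda(e)$. The lifetime is $T=\max\{t:t\in\lambda(e),e\in E\}$; the snapshot at time $t$ is $G_t=(V,E_t)$ with $E_t=\{e:t\in\lambda(e)\}$. $(G,\lambda)$ is an always star temporal graph if every snapshot $G_t$, $t\in\{1,\dots,T\}$, is a star graph (a star on its non-isolated vertices, with the remaining vertices of $V$ isolated). A vertex appearance is a pair $(v,t)$, $v\in V$, $t\in\{1,\dots,T\}$; it temporally covers edge $e$ if $v$ is an endpoint of $e$ and $t\in\lambda(e)$. For $\Delta\le T$ and $t\in\{1,\dots,T-\Delta+1\}$ let $W_t=\{t,\dots,t+\Delta-1\}$ and $E[W_t]=\bigcup_{i\in W_t}E_i$. A sliding $\Delta$-window temporal vertex cover is a set $\mathcal{S}$ of vertex appearances such that for every $t\in\{1,\dots,T-\Delta+1\}$ and every $e\in E[W_t]$, some $(w,s)\in\mathcal{S}$ with $s\in W_t$ temporally covers $e$. \textsc{Sliding Window Temporal Vertex Cover}: given $(G,\lambda)$ and $\Delta\le T$, find such a cover of minimum cardinality. *)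

theory Defs
  imports Main
begin

section \<open>Temporal graphs and sliding-window vertex covers\<close>

text \<open>Edges are two-element vertex sets; the labelling is only relevant on \<open>E\<close>.
  The edge set is required to be nonempty because otherwise the lifetime, a maximum over all
  labels, does not exist.\<close>

definition temporal_graph :: "'a set \<Rightarrow> 'a set set \<Rightarrow> ('a set \<Rightarrow> nat set) \<Rightarrow> bool" where
  "temporal_graph V E lam \<longleftrightarrow>
     finite V \<and> E \<noteq> {} \<and> (\<forall>e\<in>E. e \<subseteq> V \<and> card e = 2) \<and>
     (\<forall>e\<in>E. finite (lam e) \<and> lam e \<noteq> {} \<and> 0 \<notin> lam e)"

definition lifetime :: "'a set set \<Rightarrow> ('a set \<Rightarrow> nat set) \<Rightarrow> nat" where
  "lifetime E lam = Max (\<Union>e\<in>E. lam e)"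

definition snapshot :: "'a set set \<Rightarrow> ('a set \<Rightarrow> nat set) \<Rightarrow> nat \<Rightarrow> 'a set set" where
  "snapshot E lam t = {e \<in> E. t \<in> lam e}"

text \<open>\<open>F\<close> is the edge set of a star \<open>K\<^bsub>1,k\<^esub>\<close> with centre \<open>c\<close> and leaf set \<open>L\<close>, all other
  vertices of \<open>V\<close> being isolated. The degenerate case \<open>k = 0\<close> (no edge) is admitted.\<close>

definition star_graph :: "'a set \<Rightarrow> 'a set set \<Rightarrow> bool" where
  "star_graph V F \<longleftrightarrow> (\<exists>c\<in>V. \<exists>L \<subseteq> V - {c}. F = (\<lambda>v. {c, v}) ` L)"

definition always_star :: "'a set \<Rightarrow> 'a set set \<Rightarrow> ('a set \<Rightarrow> nat set) \<Rightarrow> bool" where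
  "always_star V E lam \<longleftrightarrow>
     temporal_graph V E lam \<and> (\<forall>t\<in>{1..lifetime E lam}. star_graph V (snapshot E lam t))"

definition temporally_covers :: "('a set \<Rightarrow> nat set) \<Rightarrow> 'a \<times> nat \<Rightarrow> 'a set \<Rightarrow> bool" where
  "temporally_covers lam = (\<lambda>(v, t) e. v \<in> e \<and> t \<in> lam e)"

definition time_window :: "nat \<Rightarrow> nat \<Rightarrow> nat set" where
  "time_window \<Delta> t = {t..<t + \<Delta>}"

definition window_edges :: "'a set set \<Rightarrow> ('a set \<Rightarrow> nat set) \<Rightarrow> nat set \<Rightarrow> 'a set set" where
  "window_edges E lam W = (\<Union>i\<in>W. snapshot E lam i)"

definition sliding_window_tvc ::
    "'a set \<Rightarrow> 'a set set \<Rightarrow> ('a set \<Rightarrow> nat set) \<Rightarrow> nat \<Rightarrow> ('a \<times> nat) set \<Rightarrow> bool" where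
  "sliding_window_tvc V E lam \<Delta> S \<longleftrightarrow>
     S \<subseteq> V \<times> {1..lifetime E lam} \<and>
     (\<forall>t\<in>{1..lifetime E lam - \<Delta> + 1}. \<forall>e\<in>window_edges E lam (time_window \<Delta> t).
        \<exists>(w, s)\<in>S. s \<in> time_window \<Delta> t \<and> temporally_covers lam (w, s) e)"

definition minimum_sliding_window_tvc ::
    "'a set \<Rightarrow> 'a set set \<Rightarrow> ('a set \<Rightarrow> nat set) \<Rightarrow> nat \<Rightarrow> ('a \<times> nat) set \<Rightarrow> bool" where
  "minimum_sliding_window_tvc V E lam \<Delta> S \<longleftrightarrow>
     is_arg_min card (sliding_window_tvc V E lam \<Delta>) S"


section \<open>Uniform-cost random access machine\<close>

text \<open>A structured RAM over the natural numbers, with registers, an indirectly addressable memory,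
  addition and truncated subtraction. There is no multiplication and no bit-parallel operation.
  Every constant, register access, memory access and arithmetic operation costs one unit, and so
  does every assignment, store and branch.\<close>

datatype exp =
    Const nat
  | Reg nat
  | Mem exp
  | Add exp exp
  | Sub exp exp

datatype com =
    Skip
  | Assign nat exp
  | Store exp exp
  | Seq com com
  | Cond exp com com
  | While exp com

type_synonym state = "(nat \<Rightarrow> nat) \<times> (nat \<Rightarrow> nat)"

fun val :: "exp \<Rightarrow> state \<Rightarrow> nat" where
  "val (Const k) s = k"
| "val (Reg r) s = fst s r"
| "val (Mem a) s = snd s (val a s)"
| "val (Add a b) s = val a s + val b s"
| "val (Sub a b) s = val a s - val b s"

fun cost :: "exp \<Rightarrow> nat" where
  "cost (Const k) = 1"
| "cost (Reg r) = 1"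
| "cost (Mem a) = cost a + 1"
| "cost (Add a b) = cost a + cost b + 1"
| "cost (Sub a b) = cost a + cost b + 1"

text \<open>\<open>exec c s k s'\<close>: started in state \<open>s\<close>, the program \<open>c\<close> halts in state \<open>s'\<close> after exactly
  \<open>k\<close> units of time. A test succeeds iff its value is nonzero.\<close>

inductive exec :: "com \<Rightarrow> state \<Rightarrow> nat \<Rightarrow> state \<Rightarrow> bool" where
  exec_Skip: "exec Skip s 1 s"
| exec_Assign: "exec (Assign r a) s (cost a + 1) ((fst s)(r := val a s), snd s)"
| exec_Store: "exec (Store a b) s (cost a + cost b + 1) (fst s, (snd s)(val a s := val b s))"
| exec_Seq: "exec c s k s' \<Longrightarrow> exec d s' l s'' \<Longrightarrow> exec (Seq c d) s (k + l) s''"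
| exec_CondTrue: "val b s \<noteq> 0 \<Longrightarrow> exec c s k s' \<Longrightarrow> exec (Cond b c d) s (cost b + 1 + k) s'"
| exec_CondFalse: "val b s = 0 \<Longrightarrow> exec d s k s' \<Longrightarrow> exec (Cond b c d) s (cost b + 1 + k) s'"
| exec_WhileFalse: "val b s = 0 \<Longrightarrow> exec (While b c) s (cost b + 1) s"
| exec_WhileTrue: "val b s \<noteq> 0 \<Longrightarrow> exec c s k s' \<Longrightarrow> exec (While b c) s' l s''
    \<Longrightarrow> exec (While b c) s (cost b + 1 + k + l) s''"

text \<open>The input word occupies memory cells \<open>0, 1, \<dots>\<close>; everything else is initially zero. On
  halting, register \<open>0\<close> holds the start address and register \<open>1\<close> the length of the output word.\<close>

definition initial_state :: "nat list \<Rightarrow> state" where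
  "initial_state xs = ((\<lambda>_. 0), (\<lambda>i. if i < length xs then xs ! i else 0))"

definition output_word :: "state \<Rightarrow> nat list" where
  "output_word s = map (snd s) [fst s 0..<fst s 0 + fst s 1]"

definition computes_in :: "com \<Rightarrow> nat list \<Rightarrow> nat list \<Rightarrow> nat \<Rightarrow> bool" where
  "computes_in p xs ys k \<longleftrightarrow> (\<exists>s. exec p (initial_state xs) k s \<and> output_word s = ys)"


section \<open>Encoding of instances and solutions\<close>

text \<open>The vertices are \<open>0, \<dots>, n - 1\<close>. The input word consists of \<open>n\<close>, the number of edges,
  \<open>\<Delta>\<close>, and for each edge its endpoints, its number of labels and its labels. Edges,
  endpoints and labels may be listed in any order, but without repetition.\<close>

definition encodes_instance ::
    "nat \<Rightarrow> nat set set \<Rightarrow> (nat set \<Rightarrow> nat set) \<Rightarrow> nat \<Rightarrow> nat list \<Rightarrow> bool" where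
  "encodes_instance n E lam \<Delta> xs \<longleftrightarrow>
     (\<exists>es. distinct (map (\<lambda>(u, v, ts). {u, v}) es) \<and>
           set (map (\<lambda>(u, v, ts). {u, v}) es) = E \<and>
           (\<forall>(u, v, ts)\<in>set es. distinct ts \<and> set ts = lam {u, v}) \<and>
           xs = [n, length es, \<Delta>] @ concat (map (\<lambda>(u, v, ts). [u, v, length ts] @ ts) es))"

definition encodes_appearances :: "(nat \<times> nat) set \<Rightarrow> nat list \<Rightarrow> bool" where
  "encodes_appearances S ys \<longleftrightarrow>
     (\<exists>ps. distinct ps \<and> set ps = S \<and> ys = concat (map (\<lambda>(v, t). [v, t]) ps))"

end

theory Submission
  imports Defs
begin

text \<open>The centre of a star snapshot covers every active edge, so a minimum cover amounts to a
  minimum set \<open>X\<close> of times at which the centre is selected. Whether a window is covered depends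
  only on the trace of \<open>X\<close> on it, which has \<open>2 ^ \<Delta>\<close> possible values; a dynamic program over these
  traces, moving the window forward by one time step at a time, finds an optimal \<open>X\<close>. Uncovered edges
  are penalised rather than forbidden, and the times before \<open>1\<close> may be selected freely at no cost, so
  the initial table is zero. Since registers hold arbitrary naturals, \<open>X\<close> itself is read off the low
  \<open>T\<close> bits of the optimal value and no traceback is needed.\<close>

section \<open>Time-bounded total correctness\<close>

text \<open>The machine lacks multiplication, division and bit operations, and this shapes the
  encoding: a trace is inspected by doubling it and testing for overflow, so its bits appear from
  newest to oldest, which is also the order of decreasing addresses in the activity row of an edge.
  A table entry requires a check of \<open>m\<close> edges over \<open>\<Delta>\<close> times,
  whence \<open>T * 2 ^ \<Delta> * m * \<Delta>\<close> steps in total; reading the input takes only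
  \<open>m * T\<close> steps up to a constant, because an edge has at most \<open>T\<close> distinct
  labels. Costs have three levels in base \<open>2 ^ T\<close>: the selected times as low bits,
  their number as multiple of \<open>2 ^ T\<close>, and the penalty \<open>2 ^ T * 2 ^ T\<close>.
  Without penalties every set of times costs less than \<open>2 ^ T * (T + 1)\<close>, hence less
  than one penalty, and the low bits only break ties between sets of equal size. A further obstacle
  is that the input does not name the centres, and that a single edge leaves both of its endpoints
  possible. Two candidates per time are therefore kept until a second edge decides between
  them.\<close>

definition runs ::
    "com \<Rightarrow> (nat \<Rightarrow> nat) \<Rightarrow> (nat \<Rightarrow> nat) \<Rightarrow> nat \<Rightarrow> ((nat \<Rightarrow> nat) \<Rightarrow> (nat \<Rightarrow> nat) \<Rightarrow> bool) \<Rightarrow> bool" where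
  "runs c R M K Q \<longleftrightarrow> (\<exists>k R' M'. exec c (R, M) k (R', M') \<and> k \<le> K \<and> Q R' M')"

lemma runs_conseq:
  assumes "runs c R M K Q" "\<And>R' M'. Q R' M' \<Longrightarrow> Q' R' M'" "K \<le> K'"
  shows "runs c R M K' Q'"
  using assms unfolding runs_def by (meson le_trans)

lemma runs_mono: "runs c R M K Q \<Longrightarrow> K \<le> K' \<Longrightarrow> runs c R M K' Q"
  by (rule runs_conseq)

lemma runs_Seq:
  assumes "runs c R M K1 Q1" "\<And>R' M'. Q1 R' M' \<Longrightarrow> runs d R' M' K2 Q" "K1 + K2 \<le> K"
  shows "runs (Seq c d) R M K Q"
proof -
  obtain k R' M' where 1: "exec c (R, M) k (R', M')" "k \<le> K1" "Q1 R' M'"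
    using assms(1) unfolding runs_def by blast
  obtain l R'' M'' where 2: "exec d (R', M') l (R'', M'')" "l \<le> K2" "Q R'' M''"
    using assms(2)[OF 1(3)] unfolding runs_def by blast
  have "k + l \<le> K"
    using 1(2) 2(2) assms(3) by linarith
  then show ?thesis
    unfolding runs_def using exec_Seq[OF 1(1) 2(1)] 2(3) by blast
qed

lemma runs_Cond:
  assumes "val b (R, M) \<noteq> 0 \<Longrightarrow> runs c R M K1 Q" "val b (R, M) = 0 \<Longrightarrow> runs d R M K1 Q"
    and "cost b + 1 + K1 \<le> K"
  shows "runs (Cond b c d) R M K Q"
proof (cases "val b (R, M) = 0")
  case True
  then obtain k R' M' where 1: "exec d (R, M) k (R', M')" "k \<le> K1" "Q R' M'"
    using assms(2) unfolding runs_def by blast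
  have "cost b + 1 + k \<le> K"
    using 1(2) assms(3) by linarith
  then show ?thesis
    unfolding runs_def using exec_CondFalse[OF True 1(1)] 1(3) by blast
next
  case False
  then obtain k R' M' where 1: "exec c (R, M) k (R', M')" "k \<le> K1" "Q R' M'"
    using assms(1) unfolding runs_def by blast
  have "cost b + 1 + k \<le> K"
    using 1(2) assms(3) by linarith
  then show ?thesis
    unfolding runs_def using exec_CondTrue[OF False 1(1)] 1(3) by blast
qed

text \<open>Since \<open>n\<close> is fixed beforehand and the invariant is indexed by the completed
  iterations, one induction on the iterations left yields both termination and running time.\<close>

lemma runs_While:
  assumes init: "I 0 R M"
    and step: "\<And>i R M. i < n \<Longrightarrow> I i R M \<Longrightarrow> val b (R, M) \<noteq> 0 \<and> runs c R M K (I (Suc i))"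
    and exit: "\<And>R M. I n R M \<Longrightarrow> val b (R, M) = 0 \<and> Q R M"
    and bound: "n * (cost b + 1 + K) + cost b + 1 \<le> K'"
  shows "runs (While b c) R M K' Q"
proof -
  have "runs (While b c) R M (j * (cost b + 1 + K) + cost b + 1) Q"
    if "I (n - j) R M" "j \<le> n" for j R M
    using that
  proof (induction j arbitrary: R M)
    case 0
    then show ?case
      using exit[of R M] exec_WhileFalse[of b "(R, M)" c] unfolding runs_def by fastforce
  next
    case (Suc j)
    have "n - Suc j < n" and eq: "Suc (n - Suc j) = n - j"
      using Suc.prems(2) by auto
    from step[OF this(1) Suc.prems(1)] eq
    have nz: "val b (R, M) \<noteq> 0" and "runs c R M K (I (n - j))"
      by auto
    then obtain k R' M' where 1: "exec c (R, M) k (R', M')" "k \<le> K" "I (n - j) R' M'"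
      unfolding runs_def by blast
    have "runs (While b c) R' M' (j * (cost b + 1 + K) + cost b + 1) Q"
      using Suc 1 by auto
    then obtain l R'' M'' where 2: "exec (While b c) (R', M') l (R'', M'')"
        "l \<le> j * (cost b + 1 + K) + cost b + 1" "Q R'' M''"
      unfolding runs_def by blast
    have "cost b + 1 + k + l \<le> Suc j * (cost b + 1 + K) + cost b + 1"
      using 1(2) 2(2) by simp
    then show ?case
      unfolding runs_def using exec_WhileTrue[OF nz 1(1) 2(1)] 2(3) by blast
  qed
  from this[of n R M] init have "runs (While b c) R M (n * (cost b + 1 + K) + cost b + 1) Q"
    by simp
  then show ?thesis
    using bound by (rule runs_mono)
qed

text \<open>Meant for loop-free code: the value \<open>False\<close> on loops keeps
  \<open>runs_wp\<close> sound although \<open>time_bound\<close> gives them 0. Straight-line pieces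
  are thus left to the simplifier.\<close>

fun wp :: "com \<Rightarrow> ((nat \<Rightarrow> nat) \<Rightarrow> (nat \<Rightarrow> nat) \<Rightarrow> bool) \<Rightarrow> (nat \<Rightarrow> nat) \<Rightarrow> (nat \<Rightarrow> nat) \<Rightarrow> bool" where
  "wp Skip Q R M = Q R M"
| "wp (Assign r a) Q R M = Q (R(r := val a (R, M))) M"
| "wp (Store a b) Q R M = Q R (M(val a (R, M) := val b (R, M)))"
| "wp (Seq c d) Q R M = wp c (wp d Q) R M"
| "wp (Cond b c d) Q R M =
     ((val b (R, M) \<noteq> 0 \<longrightarrow> wp c Q R M) \<and> (val b (R, M) = 0 \<longrightarrow> wp d Q R M))"
| "wp (While b c) Q R M = False"

fun time_bound :: "com \<Rightarrow> nat" where
  "time_bound Skip = 1"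
| "time_bound (Assign r a) = cost a + 1"
| "time_bound (Store a b) = cost a + cost b + 1"
| "time_bound (Seq c d) = time_bound c + time_bound d"
| "time_bound (Cond b c d) = cost b + 1 + max (time_bound c) (time_bound d)"
| "time_bound (While b c) = 0"

lemma runs_wp:
  assumes "wp c Q R M" "time_bound c \<le> K"
  shows "runs c R M K Q"
proof -
  have "runs c R M (time_bound c) Q"
    using assms(1)
  proof (induction c arbitrary: Q R M)
    case Skip
    then show ?case
      unfolding runs_def using exec_Skip by fastforce
  next
    case (Assign r a)
    then show ?case
      unfolding runs_def using exec_Assign[of r a "(R, M)"] by fastforce
  next
    case (Store a b)
    then show ?case
      unfolding runs_def using exec_Store[of a b "(R, M)"] by fastforce
  next
    case (Seq c d)
    show ?case
      by (rule runs_Seq[OF Seq.IH(1)[of "wp d Q"] Seq.IH(2)]) (use Seq.prems in auto)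
  next
    case (Cond b c d)
    show ?case
    proof (rule runs_Cond[where ?K1.0 = "max (time_bound c) (time_bound d)"])
      assume "val b (R, M) \<noteq> 0"
      then show "runs c R M (max (time_bound c) (time_bound d)) Q"
        using Cond.prems by (intro runs_mono[OF Cond.IH(1)]) auto
    next
      assume "val b (R, M) = 0"
      then show "runs d R M (max (time_bound c) (time_bound d)) Q"
        using Cond.prems by (intro runs_mono[OF Cond.IH(2)]) auto
    qed simp
  qed simp
  then show ?thesis
    using assms(2) by (rule runs_mono)
qed

section \<open>The dynamic program\<close>

text \<open>A number \<open>A < 2 ^ \<Delta>\<close> encodes the subset of times in \<open>{t - \<Delta> + 1..t}\<close> that are selected; the most
  significant bit belongs to the newest time \<open>t\<close>, so that doubling modulo \<open>2 ^ \<Delta>\<close> shifts it out.\<close>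

definition doubled :: "nat \<Rightarrow> nat \<Rightarrow> nat \<Rightarrow> nat" where
  "doubled \<Delta> i A = (2 ^ i * A) mod 2 ^ \<Delta>"

text \<open>After \<open>i\<close> doublings modulo \<open>2 ^ \<Delta>\<close> the bit of time
  \<open>t - i\<close> is the top bit, and the top bit is set iff one more doubling
  overflows.\<close>

definition nth_newest :: "nat \<Rightarrow> nat \<Rightarrow> nat \<Rightarrow> bool" where
  "nth_newest \<Delta> i A \<longleftrightarrow> 2 ^ \<Delta> \<le> 2 * doubled \<Delta> i A"

text \<open>A window is named by its last time \<open>t\<close> and consists of the times
  \<open>t - i\<close> with \<open>i < \<Delta>\<close>. For \<open>\<Delta> \<le> t\<close>, the
  case in which \<open>penalty\<close> consults it, these times are all positive.\<close>

definition uncovered :: "(nat \<Rightarrow> nat \<Rightarrow> bool) \<Rightarrow> nat \<Rightarrow> nat \<Rightarrow> nat \<Rightarrow> nat \<Rightarrow> bool" where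
  "uncovered act \<Delta> t A e \<longleftrightarrow>
     (\<exists>i<\<Delta>. act e (t - i)) \<and> \<not> (\<exists>i<\<Delta>. act e (t - i) \<and> nth_newest \<Delta> i A)"

text \<open>No window ends before time \<open>\<Delta>\<close>. The amount exceeds the cost of
  selecting all times, so a single uncovered edge in a single window already rules a choice
  out.\<close>

definition penalty :: "nat \<Rightarrow> (nat \<Rightarrow> nat \<Rightarrow> bool) \<Rightarrow> nat \<Rightarrow> nat \<Rightarrow> nat \<Rightarrow> nat \<Rightarrow> nat" where
  "penalty m act \<Delta> T t A =
     (if \<Delta> \<le> t \<and> (\<exists>e<m. uncovered act \<Delta> t A e) then 2 ^ T * 2 ^ T else 0)"

text \<open>Selecting time \<open>t\<close> costs \<open>2 ^ T + 2 ^ (t - 1)\<close>: the multiple of \<open>2 ^ T\<close> counts the selected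
  times, and the remainder modulo \<open>2 ^ T\<close> records which times they are.\<close>

definition local_cost :: "nat \<Rightarrow> (nat \<Rightarrow> nat \<Rightarrow> bool) \<Rightarrow> nat \<Rightarrow> nat \<Rightarrow> nat \<Rightarrow> nat \<Rightarrow> nat" where
  "local_cost m act \<Delta> T t A =
     (if 2 ^ \<Delta> \<le> 2 * A then 2 ^ T + 2 ^ (t - 1) else 0) + penalty m act \<Delta> T t A"

text \<open>Doubling drops the bit of the newest time and vacates the lowest position. That position
  belongs to the time which has just left the window, so both of its values are admissible
  predecessors.\<close>

fun dp_row :: "nat \<Rightarrow> (nat \<Rightarrow> nat \<Rightarrow> bool) \<Rightarrow> nat \<Rightarrow> nat \<Rightarrow> nat \<Rightarrow> nat \<Rightarrow> nat" where
  "dp_row m act \<Delta> T 0 A = 0"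
| "dp_row m act \<Delta> T (Suc t) A =
     min (dp_row m act \<Delta> T t (doubled \<Delta> 1 A)) (dp_row m act \<Delta> T t (doubled \<Delta> 1 A + 1))
     + local_cost m act \<Delta> T (Suc t) A"

text \<open>A walk in the binary de Bruijn graph on words of length \<open>\<Delta>\<close>, listed
  by time; going back one step appends an arbitrary lowest bit.\<close>

definition walk :: "nat \<Rightarrow> nat \<Rightarrow> (nat \<Rightarrow> nat) \<Rightarrow> bool" where
  "walk \<Delta> t g \<longleftrightarrow> (\<forall>s\<le>t. g s < 2 ^ \<Delta>) \<and>
     (\<forall>s<t. g s = doubled \<Delta> 1 (g (Suc s)) \<or> g s = doubled \<Delta> 1 (g (Suc s)) + 1)"

definition walk_cost ::
    "nat \<Rightarrow> (nat \<Rightarrow> nat \<Rightarrow> bool) \<Rightarrow> nat \<Rightarrow> nat \<Rightarrow> nat \<Rightarrow> (nat \<Rightarrow> nat) \<Rightarrow> nat" where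
  "walk_cost m act \<Delta> T t g = (\<Sum>s=1..t. local_cost m act \<Delta> T s (g s))"

definition good_times :: "nat \<Rightarrow> (nat \<Rightarrow> nat \<Rightarrow> bool) \<Rightarrow> nat \<Rightarrow> nat \<Rightarrow> nat set \<Rightarrow> bool" where
  "good_times m act \<Delta> T X \<longleftrightarrow> X \<subseteq> {1..T} \<and>
     (\<forall>t\<in>{\<Delta>..T}. \<forall>e<m. (\<exists>i<\<Delta>. act e (t - i)) \<longrightarrow> (\<exists>i<\<Delta>. act e (t - i) \<and> t - i \<in> X))"

definition time_code :: "nat set \<Rightarrow> nat" where
  "time_code X = (\<Sum>s\<in>X. 2 ^ (s - 1))"

section \<open>Arithmetic of shifted traces\<close>

lemma doubled_0: "A < 2 ^ \<Delta> \<Longrightarrow> doubled \<Delta> 0 A = A"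
  by (simp add: doubled_def)

lemma doubled_less: "doubled \<Delta> i A < 2 ^ \<Delta>"
  by (simp add: doubled_def)

text \<open>The doubled value stays below \<open>2 * 2 ^ \<Delta>\<close>, so reduction modulo
  \<open>2 ^ \<Delta>\<close> is at most one subtraction. This is the form the machine can
  execute.\<close>

lemma doubled_Suc:
  "doubled \<Delta> (Suc i) A =
    (if 2 ^ \<Delta> \<le> 2 * doubled \<Delta> i A then 2 * doubled \<Delta> i A - 2 ^ \<Delta> else 2 * doubled \<Delta> i A)"
proof -
  have "doubled \<Delta> (Suc i) A = (2 * doubled \<Delta> i A) mod 2 ^ \<Delta>"
    by (simp add: doubled_def mult.assoc mod_mult_right_eq)
  moreover have "2 * doubled \<Delta> i A < 2 * 2 ^ \<Delta>"
    using doubled_less[of \<Delta> i A] by simp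
  ultimately show ?thesis
    by (auto simp: mod_if le_mod_geq)
qed

lemma doubled_1:
  "A < 2 ^ \<Delta> \<Longrightarrow> doubled \<Delta> 1 A = (if 2 ^ \<Delta> \<le> 2 * A then 2 * A - 2 ^ \<Delta> else 2 * A)"
  using doubled_Suc[of \<Delta> 0 A] by (simp add: doubled_0)

text \<open>An even number below the even number \<open>2 ^ \<Delta>\<close> is not its predecessor;
  hence the second option in \<open>dp_row\<close> is also a valid trace.\<close>

lemma doubled_1_Suc_less:
  assumes "1 \<le> \<Delta>" shows "doubled \<Delta> 1 A + 1 < 2 ^ \<Delta>"
proof -
  have "even (doubled \<Delta> 1 A)" "even ((2::nat) ^ \<Delta>)"
    using assms by (simp_all add: doubled_def dvd_mod)
  with doubled_less[of \<Delta> 1 A] show ?thesis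
    by (metis Suc_eq_plus1 Suc_lessI even_Suc)
qed

section \<open>Table entries as minimum costs of walks\<close>

lemma dp_row_le_walk_cost:
  assumes "walk \<Delta> t g"
  shows "dp_row m act \<Delta> T t (g t) \<le> walk_cost m act \<Delta> T t g"
  using assms
proof (induction t)
  case 0
  then show ?case by simp
next
  case (Suc t)
  then have "walk \<Delta> t g"
    by (simp add: walk_def)
  with Suc have "dp_row m act \<Delta> T t (g t) \<le> walk_cost m act \<Delta> T t g"
    by simp
  moreover have "g t = doubled \<Delta> 1 (g (Suc t)) \<or> g t = doubled \<Delta> 1 (g (Suc t)) + 1"
    using Suc.prems by (simp add: walk_def)
  ultimately show ?case
    by (auto simp: walk_cost_def simp del: One_nat_def)
qed

text \<open>An optimal walk to the cheaper predecessor \<open>B\<close> is extended by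
  \<open>A\<close>; earlier costs do not see the new value.\<close>

lemma dp_row_attained:
  assumes "1 \<le> \<Delta>" "A < 2 ^ \<Delta>"
  shows "\<exists>g. walk \<Delta> t g \<and> g t = A \<and> dp_row m act \<Delta> T t A = walk_cost m act \<Delta> T t g"
  using assms(2)
proof (induction t arbitrary: A)
  case 0
  then show ?case
    by (intro exI[of _ "\<lambda>_. A"]) (simp add: walk_def walk_cost_def)
next
  case (Suc t)
  define B where "B = (if dp_row m act \<Delta> T t (doubled \<Delta> 1 A) \<le> dp_row m act \<Delta> T t (doubled \<Delta> 1 A + 1)
    then doubled \<Delta> 1 A else doubled \<Delta> 1 A + 1)"
  have "B < 2 ^ \<Delta>"
    using doubled_1_Suc_less[OF assms(1), of A] by (simp add: B_def)
  from Suc.IH[OF this] obtain g where g: "walk \<Delta> t g" "g t = B"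
      "dp_row m act \<Delta> T t B = walk_cost m act \<Delta> T t g"
    by blast
  let ?g = "g(Suc t := A)"
  have "walk \<Delta> (Suc t) ?g"
    using g(1,2) Suc.prems by (auto simp: walk_def less_Suc_eq le_Suc_eq B_def)
  moreover have "walk_cost m act \<Delta> T t ?g = walk_cost m act \<Delta> T t g"
    by (simp add: walk_cost_def)
  then have "dp_row m act \<Delta> T (Suc t) A = walk_cost m act \<Delta> T (Suc t) ?g"
    using g(3) by (auto simp: B_def walk_cost_def simp del: One_nat_def split: if_splits)
  ultimately show ?case
    by (metis fun_upd_same)
qed

text \<open>Going back \<open>i\<close> steps from \<open>g t\<close> shifts it \<open>i\<close>
  times and fills the \<open>i\<close> lowest positions with unknown bits \<open>d < 2 ^ i\<close>.
  Because \<open>i < \<Delta>\<close>, the top bit is not among them, so one trace records all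
  selections in its window.\<close>

lemma walk_nth_newest:
  assumes "walk \<Delta> t g" "i < \<Delta>" "i \<le> t"
  shows "nth_newest \<Delta> i (g t) \<longleftrightarrow> 2 ^ \<Delta> \<le> 2 * g (t - i)"
proof -
  have *: "\<exists>d<2 ^ i. g (t - i) = doubled \<Delta> i (g t) + d" if "i < \<Delta>" "i \<le> t" for i
    using that
  proof (induction i)
    case 0
    then show ?case
      using assms(1) by (simp add: walk_def doubled_0)
  next
    case (Suc i)
    then obtain d where d: "d < 2 ^ i" "g (t - i) = doubled \<Delta> i (g t) + d"
      by auto
    have "Suc (t - Suc i) = t - i"
      using Suc.prems by simp
    then obtain c where c: "c < 2" "g (t - Suc i) = doubled \<Delta> 1 (g (t - i)) + c"
      using assms(1) Suc.prems unfolding walk_def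
      by (metis One_nat_def Suc_1 add.right_neutral diff_less less_2_cases_iff zero_less_Suc
          less_le_trans)
    \<comment> \<open>Both the shifted trace and \<open>2 ^ \<Delta>\<close> are multiples of
      \<open>2 ^ Suc i\<close>, so at least that much room lies between them and the appended low
      bits cannot overflow.\<close>
    have dv: "2 ^ Suc i dvd doubled \<Delta> (Suc i) (g t)"
      unfolding doubled_def
      by (intro dvd_mod dvd_triv_left le_imp_power_dvd) (use Suc.prems in simp)
    have dv2: "(2::nat) ^ Suc i dvd 2 ^ \<Delta>"
      by (rule le_imp_power_dvd) (use Suc.prems in simp)
    have dP: "doubled \<Delta> (Suc i) (g t) + 2 ^ Suc i \<le> 2 ^ \<Delta>"
      using doubled_less[of \<Delta> "Suc i" "g t"] dv dv2
      by (metis add.commute dvd_diff_nat dvd_imp_le le_diff_conv2 less_imp_le zero_less_diff)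
    have "doubled \<Delta> 1 (g (t - i)) = (2 * doubled \<Delta> i (g t) + 2 * d) mod 2 ^ \<Delta>"
      unfolding doubled_def[of _ 1] d(2) by (simp only: power_one_right distrib_left)
    also have "\<dots> = (doubled \<Delta> (Suc i) (g t) + 2 * d) mod 2 ^ \<Delta>"
      unfolding doubled_def power_Suc mult.assoc by (metis mod_add_left_eq mod_mult_right_eq)
    also have "\<dots> = doubled \<Delta> (Suc i) (g t) + 2 * d"
      using dP d(1) by simp
    \<comment> \<open>The old low bits move up by one position and \<open>c\<close> is the newly
      appended bit.\<close>
    finally show ?case
      using c d(1) by (intro exI[of _ "2 * d + c"]) auto
  qed
  obtain d where d: "d < 2 ^ i" "g (t - i) = doubled \<Delta> i (g t) + d"
    using *[OF assms(2,3)] by auto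
  \<comment> \<open>Only this direction is at risk, since \<open>d\<close> enlarges
    \<open>g (t - i)\<close>. A multiple of \<open>2 ^ Suc i\<close> below
    \<open>2 ^ \<Delta>\<close> misses it by at least \<open>2 ^ Suc i\<close>, more than
    \<open>2 * d\<close> can make up.\<close>
  have "2 ^ \<Delta> \<le> 2 * doubled \<Delta> i (g t)" if "2 ^ \<Delta> \<le> 2 * g (t - i)"
  proof (rule ccontr)
    assume "\<not> ?thesis"
    then have "2 * doubled \<Delta> i (g t) < 2 ^ \<Delta>"
      by simp
    moreover have "2 ^ Suc i dvd 2 * doubled \<Delta> i (g t)"
      unfolding doubled_def using assms(2)
      by (simp, intro dvd_mod) (auto simp: le_imp_power_dvd)
    moreover have "(2::nat) ^ Suc i dvd 2 ^ \<Delta>"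
      using assms(2) by (intro le_imp_power_dvd) simp
    ultimately have "2 ^ Suc i \<le> 2 ^ \<Delta> - 2 * doubled \<Delta> i (g t)"
      by (intro dvd_imp_le dvd_diff_nat) auto
    then show False
      using that d by simp
  qed
  then show ?thesis
    using d(2) by (auto simp: nth_newest_def)
qed

text \<open>Turns a set of times into a walk: halving ages every selection by one step, and
  \<open>2 ^ (\<Delta> - 1)\<close> enters the current time as top bit. The start value 0 selects
  nothing before time 1.\<close>

primrec walk_of :: "nat \<Rightarrow> nat set \<Rightarrow> nat \<Rightarrow> nat" where
  "walk_of \<Delta> X 0 = 0"
| "walk_of \<Delta> X (Suc s) = walk_of \<Delta> X s div 2 + (if Suc s \<in> X then 2 ^ (\<Delta> - 1) else 0)"

lemma walk_of_less:
  assumes "1 \<le> \<Delta>" shows "walk_of \<Delta> X s < 2 ^ \<Delta>"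
proof (induction s)
  case (Suc s)
  have "(2::nat) ^ \<Delta> = 2 * 2 ^ (\<Delta> - 1)"
    using assms by (simp add: power_eq_if)
  with Suc show ?case
    by auto
qed simp

text \<open>Halving loses only the lowest bit, which a walk is free to choose.\<close>

lemma walk_walk_of:
  assumes "1 \<le> \<Delta>" shows "walk \<Delta> t (walk_of \<Delta> X)"
proof -
  have P: "(2::nat) ^ \<Delta> = 2 * 2 ^ (\<Delta> - 1)"
    using assms by (simp add: power_eq_if)
  have "doubled \<Delta> 1 (walk_of \<Delta> X (Suc s)) = 2 * (walk_of \<Delta> X s div 2)" for s
  proof -
    have "2 * (walk_of \<Delta> X s div 2) < 2 ^ \<Delta>"
      using walk_of_less[OF assms, of X s] by linarith
    then show ?thesis
      using P by (auto simp: doubled_def distrib_left)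
  qed
  then show ?thesis
    unfolding walk_def using walk_of_less[OF assms] by auto
qed

text \<open>A halved trace has no top bit, so the top bit is set exactly when it has just been
  added.\<close>

lemma newest_walk_of:
  assumes "1 \<le> \<Delta>" "1 \<le> s"
  shows "2 ^ \<Delta> \<le> 2 * walk_of \<Delta> X s \<longleftrightarrow> s \<in> X"
proof -
  obtain r where s: "s = Suc r"
    using assms(2) by (cases s) auto
  have P: "(2::nat) ^ \<Delta> = 2 * 2 ^ (\<Delta> - 1)"
    using assms by (simp add: power_eq_if)
  show ?thesis
    using P walk_of_less[OF assms(1), of X r] by (auto simp: s)
qed

text \<open>The cost splits into a selection part, determined by \<open>X\<close>, and a sum of
  penalties. By \<open>walk_nth_newest\<close> the penalties test exactly the windows of
  \<open>X\<close>: their sum vanishes for good \<open>X\<close> and otherwise contains a full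
  term.\<close>

lemma walk_cost_eq:
  assumes "walk \<Delta> T g" and X: "X = {s\<in>{1..T}. 2 ^ \<Delta> \<le> 2 * g s}"
  shows "good_times m act \<Delta> T X \<Longrightarrow> walk_cost m act \<Delta> T T g = 2 ^ T * card X + time_code X"
    and "\<not> good_times m act \<Delta> T X \<Longrightarrow> 2 ^ T * 2 ^ T \<le> walk_cost m act \<Delta> T T g"
proof -
  have unc: "uncovered act \<Delta> t (g t) e \<longleftrightarrow>
      (\<exists>i<\<Delta>. act e (t - i)) \<and> \<not> (\<exists>i<\<Delta>. act e (t - i) \<and> t - i \<in> X)"
    if "\<Delta> \<le> t" "t \<le> T" for t e
  proof -
    have "walk \<Delta> t g"
      using assms(1) that by (simp add: walk_def)
    then have "nth_newest \<Delta> i (g t) \<longleftrightarrow> t - i \<in> X" if "i < \<Delta>" for i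
      using walk_nth_newest[of \<Delta> t g i] that \<open>\<Delta> \<le> t\<close> \<open>t \<le> T\<close> by (auto simp: X)
    then show ?thesis
      by (auto simp: uncovered_def)
  qed
  have XT: "X \<subseteq> {1..T}"
    by (auto simp: X)
  have good: "good_times m act \<Delta> T X \<longleftrightarrow> (\<forall>t\<in>{1..T}. penalty m act \<Delta> T t (g t) = 0)"
  proof -
    have "good_times m act \<Delta> T X \<longleftrightarrow> (\<forall>t\<in>{\<Delta>..T}. \<forall>e<m. \<not> uncovered act \<Delta> t (g t) e)"
      unfolding good_times_def using unc XT by simp blast
    \<comment> \<open>The two ranges can differ only at \<open>t = 0\<close>, which requires
      \<open>\<Delta> = 0\<close>; windows are then empty and nothing is uncovered.\<close>
    also have "\<dots> \<longleftrightarrow> (\<forall>t\<in>{1..T}. \<Delta> \<le> t \<longrightarrow> (\<forall>e<m. \<not> uncovered act \<Delta> t (g t) e))"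
    proof -
      have "\<not> uncovered act \<Delta> 0 (g 0) e" if "\<Delta> = 0" for e
        using that by (simp add: uncovered_def)
      then show ?thesis
        by (metis One_nat_def Suc_leI atLeastAtMost_iff le_zero_eq not_gr_zero)
    qed
    also have "\<dots> \<longleftrightarrow> (\<forall>t\<in>{1..T}. penalty m act \<Delta> T t (g t) = 0)"
      by (auto simp: penalty_def)
    finally show ?thesis .
  qed
  have fin: "finite X"
    by (simp add: X)
  have "(\<Sum>s=1..T. if 2 ^ \<Delta> \<le> 2 * g s then 2 ^ T + 2 ^ (s - 1) else 0) = (\<Sum>s\<in>X. 2 ^ T + (2::nat) ^ (s - 1))"
    unfolding X by (rule sum.inter_filter[symmetric]) simp
  also have "\<dots> = 2 ^ T * card X + time_code X"
    by (simp add: sum.distrib time_code_def)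
  finally have main: "walk_cost m act \<Delta> T T g =
      2 ^ T * card X + time_code X + (\<Sum>s=1..T. penalty m act \<Delta> T s (g s))"
    by (simp add: walk_cost_def local_cost_def sum.distrib)
  show "walk_cost m act \<Delta> T T g = 2 ^ T * card X + time_code X" if "good_times m act \<Delta> T X"
    using main that good by simp
  show "2 ^ T * 2 ^ T \<le> walk_cost m act \<Delta> T T g" if bad: "\<not> good_times m act \<Delta> T X"
  proof -
    obtain t where t: "t \<in> {1..T}" "penalty m act \<Delta> T t (g t) \<noteq> 0"
      using bad good by blast
    then have "2 ^ T * 2 ^ T = penalty m act \<Delta> T t (g t)"
      by (auto simp: penalty_def split: if_splits)
    also have "\<dots> \<le> (\<Sum>s=1..T. penalty m act \<Delta> T s (g s))"
      using t(1) by (intro member_le_sum) auto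
    finally show ?thesis
      using main by simp
  qed
qed

section \<open>Reading an optimal set of times off the minimum table entry\<close>

lemma time_code_less:
  assumes "X \<subseteq> {1..T}" shows "time_code X < 2 ^ T"
proof -
  have "time_code X \<le> time_code {1..T}"
    unfolding time_code_def using assms by (intro sum_mono2) auto
  also have "\<dots> < 2 ^ T"
    by (induction T) (auto simp: time_code_def)
  finally show ?thesis .
qed

text \<open>Good sets and penalty-free walks correspond, so \<open>v\<close> is at most the cost of
  every good set and equals the cost of one. As codes stay below \<open>2 ^ T\<close>, minimising
  the combined number minimises the cardinality first.\<close>

lemma dp_optimum:
  assumes "1 \<le> \<Delta>"
    and lower: "\<And>A. A < 2 ^ \<Delta> \<Longrightarrow> v \<le> dp_row m act \<Delta> T T A"
    and attained: "A0 < 2 ^ \<Delta>" "v = dp_row m act \<Delta> T T A0"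
  shows "\<exists>X. good_times m act \<Delta> T X \<and> v = 2 ^ T * card X + time_code X \<and>
           (\<forall>Y. good_times m act \<Delta> T Y \<longrightarrow> card X \<le> card Y)"
proof -
  have upper: "v \<le> 2 ^ T * card Y + time_code Y" if Y: "good_times m act \<Delta> T Y" for Y
  proof -
    have "Y = {s\<in>{1..T}. 2 ^ \<Delta> \<le> 2 * walk_of \<Delta> Y s}"
      using Y newest_walk_of[OF assms(1)] by (auto simp: good_times_def)
    from walk_cost_eq(1)[OF walk_walk_of[OF assms(1)] this Y]
    show ?thesis
      using lower[OF walk_of_less[OF assms(1)], of Y T]
        dp_row_le_walk_cost[OF walk_walk_of[OF assms(1)], of m act T T Y]
      by linarith
  qed
  obtain g where g: "walk \<Delta> T g" "g T = A0" "v = walk_cost m act \<Delta> T T g"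
    using dp_row_attained[OF assms(1) attained(1)] attained(2) by metis
  define X where "X = {s\<in>{1..T}. 2 ^ \<Delta> \<le> 2 * g s}"
  \<comment> \<open>Selecting every time is good; its cost bounds \<open>v\<close> strictly below
    one penalty, via \<open>T + 1 \<le> 2 ^ T\<close>.\<close>
  have full: "good_times m act \<Delta> T {1..T}"
    by (force simp: good_times_def)
  have "T + 1 \<le> 2 ^ T"
    by (induction T) auto
  then have "2 ^ T * (T + 1) \<le> (2::nat) ^ T * 2 ^ T"
    by (rule mult_le_mono2)
  then have "v < 2 ^ T * 2 ^ T"
    using upper[OF full] time_code_less[of "{1..T}" T] by simp
  then have X: "good_times m act \<Delta> T X"
    using walk_cost_eq(2)[OF g(1) X_def] g(3) by (meson not_le)
  then have v: "v = 2 ^ T * card X + time_code X"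
    using walk_cost_eq(1)[OF g(1) X_def] g(3) by simp
  have "card X \<le> card Y" if Y: "good_times m act \<Delta> T Y" for Y
  proof -
    have "2 ^ T * card X \<le> v"
      using v by simp
    \<comment> \<open>The code of \<open>Y\<close> adds less than one unit of \<open>2 ^ T\<close>,
      so cancelling this factor compares the cardinalities.\<close>
    also have "\<dots> < 2 ^ T * (card Y + 1)"
      using upper[OF Y] time_code_less[of Y T] Y by (simp add: good_times_def)
    finally show ?thesis
      by (simp only: mult_less_cancel1) simp
  qed
  with X v show ?thesis
    by blast
qed

section \<open>Reduction to selecting times\<close>

text \<open>Windows are renamed from their first to their last time, the start being
  \<open>t + 1 - \<Delta>\<close>. This is the indexing of the dynamic program, where a window is
  complete once its last time is reached.\<close>

lemma sliding_window_tvc_altdef: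
  assumes "1 \<le> \<Delta>" "\<Delta> \<le> lifetime E lam"
  shows "sliding_window_tvc V E lam \<Delta> S \<longleftrightarrow>
     S \<subseteq> V \<times> {1..lifetime E lam} \<and>
     (\<forall>t\<in>{\<Delta>..lifetime E lam}. \<forall>e\<in>E. (\<exists>i<\<Delta>. t - i \<in> lam e) \<longrightarrow>
        (\<exists>(w, s)\<in>S. (\<exists>i<\<Delta>. s = t - i) \<and> w \<in> e \<and> s \<in> lam e))"
    (is "_ \<longleftrightarrow> _ \<and> ?rhs")
proof -
  let ?T = "lifetime E lam"
  have win: "s \<in> time_window \<Delta> (t + 1 - \<Delta>) \<longleftrightarrow> (\<exists>i<\<Delta>. s = t - i)" if "\<Delta> \<le> t" for s t
  proof
    assume "s \<in> time_window \<Delta> (t + 1 - \<Delta>)"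
    then show "\<exists>i<\<Delta>. s = t - i"
      using that assms(1) by (intro exI[of _ "t - s"]) (auto simp: time_window_def)
  qed (use that in \<open>auto simp: time_window_def\<close>)
  have img: "{1..?T - \<Delta> + 1} = (\<lambda>t. t + 1 - \<Delta>) ` {\<Delta>..?T}"
  proof (intro equalityI subsetI)
    fix x assume "x \<in> {1..?T - \<Delta> + 1}"
    then show "x \<in> (\<lambda>t. t + 1 - \<Delta>) ` {\<Delta>..?T}"
      using assms(2) by (intro image_eqI[of _ _ "x + \<Delta> - 1"]) auto
  qed auto
  have ball_image: "(\<forall>x\<in>f ` B. Q x) \<longleftrightarrow> (\<forall>x\<in>B. Q (f x))"
    for f :: "nat \<Rightarrow> nat" and B Q
    by blast
  have "(\<forall>t\<in>{1..?T - \<Delta> + 1}. \<forall>e\<in>window_edges E lam (time_window \<Delta> t).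
          \<exists>(w, s)\<in>S. s \<in> time_window \<Delta> t \<and> temporally_covers lam (w, s) e) \<longleftrightarrow> ?rhs"
    unfolding img ball_image
  proof (rule ball_cong[OF refl])
    fix t assume "t \<in> {\<Delta>..?T}"
    then have t: "\<Delta> \<le> t" by simp
    show "(\<forall>e\<in>window_edges E lam (time_window \<Delta> (t + 1 - \<Delta>)).
          \<exists>(w, s)\<in>S. s \<in> time_window \<Delta> (t + 1 - \<Delta>) \<and> temporally_covers lam (w, s) e) \<longleftrightarrow>
        (\<forall>e\<in>E. (\<exists>i<\<Delta>. t - i \<in> lam e) \<longrightarrow>
          (\<exists>(w, s)\<in>S. (\<exists>i<\<Delta>. s = t - i) \<and> w \<in> e \<and> s \<in> lam e))"
    proof -
      have "e \<in> window_edges E lam (time_window \<Delta> (t + 1 - \<Delta>)) \<longleftrightarrow>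
          e \<in> E \<and> (\<exists>s. s \<in> time_window \<Delta> (t + 1 - \<Delta>) \<and> s \<in> lam e)" for e
        by (auto simp: window_edges_def snapshot_def)
      then have edges: "e \<in> window_edges E lam (time_window \<Delta> (t + 1 - \<Delta>)) \<longleftrightarrow>
          e \<in> E \<and> (\<exists>i<\<Delta>. t - i \<in> lam e)" for e
        unfolding win[OF t] by blast
      have ball_restrict: "(\<forall>x\<in>A. Q x) \<longleftrightarrow> (\<forall>x\<in>B. C x \<longrightarrow> Q x)"
        if "\<And>x. x \<in> A \<longleftrightarrow> x \<in> B \<and> C x" for A B :: "'a set set" and C Q
        using that by blast
      show ?thesis
        unfolding win[OF t] temporally_covers_def prod.case by (rule ball_restrict) (rule edges)
    qed
  qed
  then show ?thesis
    unfolding sliding_window_tvc_def by (rule conj_cong[OF refl])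
qed

text \<open>In a star snapshot the centre covers every active edge, so all appearances selected at one
  time can be exchanged for the single appearance of the centre.\<close>

lemma minimum_sliding_window_tvcI:
  fixes edge :: "nat \<Rightarrow> 'a set"
  assumes "1 \<le> \<Delta>" "\<Delta> \<le> lifetime E lam" "finite V"
    and E: "E = edge ` {..<m}"
    and centre: "\<And>t. t \<in> {1..lifetime E lam} \<Longrightarrow> c t \<in> V \<and> (\<forall>e\<in>snapshot E lam t. c t \<in> e)"
    and X: "good_times m (\<lambda>i t. t \<in> lam (edge i)) \<Delta> (lifetime E lam) X"
    and opt: "\<And>Y. good_times m (\<lambda>i t. t \<in> lam (edge i)) \<Delta> (lifetime E lam) Y \<Longrightarrow> card X \<le> card Y"
  shows "minimum_sliding_window_tvc V E lam \<Delta> ((\<lambda>t. (c t, t)) ` X)"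
proof -
  let ?T = "lifetime E lam" and ?S = "(\<lambda>t. (c t, t)) ` X"
  have XT: "X \<subseteq> {1..?T}"
    using X by (simp add: good_times_def)
  have "sliding_window_tvc V E lam \<Delta> ?S"
    unfolding sliding_window_tvc_altdef[OF assms(1,2)]
  proof (intro conjI ballI impI)
    show "?S \<subseteq> V \<times> {1..?T}"
      using centre XT by auto
    fix t e assume t: "t \<in> {\<Delta>..?T}" and e: "e \<in> E" and ex: "\<exists>i<\<Delta>. t - i \<in> lam e"
    obtain k where k: "k < m" "e = edge k"
      using e E by auto
    have "\<exists>i<\<Delta>. t - i \<in> lam (edge k) \<and> t - i \<in> X"
      using X t k(1) ex unfolding good_times_def k(2) by simp
    then obtain i where i: "i < \<Delta>" "t - i \<in> lam e" "t - i \<in> X"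
      unfolding k(2) by blast
    then have "c (t - i) \<in> e"
      using centre[of "t - i"] e XT by (auto simp: snapshot_def)
    with i show "\<exists>(w, s)\<in>?S. (\<exists>i<\<Delta>. s = t - i) \<and> w \<in> e \<and> s \<in> lam e"
      by auto
  qed
  moreover have "card ?S \<le> card S" if S: "sliding_window_tvc V E lam \<Delta> S" for S
  proof -
    have sub: "S \<subseteq> V \<times> {1..?T}"
      using S by (simp add: sliding_window_tvc_def)
    then have fin: "finite S"
      using assms(3) by (auto intro: finite_subset)
    \<comment> \<open>Forgetting the vertices of an arbitrary cover leaves a good set of times that
      is no larger, so no cover is smaller than \<open>X\<close>.\<close>
    have "good_times m (\<lambda>i t. t \<in> lam (edge i)) \<Delta> ?T (snd ` S)"
      unfolding good_times_def
    proof (intro conjI ballI allI impI)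
      show "snd ` S \<subseteq> {1..?T}"
        using sub by auto
      fix t k assume t: "t \<in> {\<Delta>..?T}" and k: "k < m" and ex: "\<exists>i<\<Delta>. t - i \<in> lam (edge k)"
      have "edge k \<in> E"
        using E k by simp
      with S t ex have "\<exists>(w, s)\<in>S. (\<exists>i<\<Delta>. s = t - i) \<and> w \<in> edge k \<and> s \<in> lam (edge k)"
        unfolding sliding_window_tvc_altdef[OF assms(1,2)] by simp
      then obtain w s where "(w, s) \<in> S" "\<exists>i<\<Delta>. s = t - i" "s \<in> lam (edge k)"
        by auto
      then show "\<exists>i<\<Delta>. t - i \<in> lam (edge k) \<and> t - i \<in> snd ` S"
        by force
    qed
    then have "card X \<le> card (snd ` S)"
      by (rule opt)
    also have "\<dots> \<le> card S"
      using fin by (rule card_image_le)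
    finally show ?thesis
      by (simp add: card_image inj_on_def)
  qed
  ultimately show ?thesis
    by (simp add: minimum_sliding_window_tvc_def is_arg_min_linorder)
qed

section \<open>The program\<close>

notation Seq (infixr ";;" 60)
notation Assign (infix "::=" 65)

text \<open>Numbers follow the nesting of the loops: the input scan owns 3 to 8, values fixed before
  the dynamic program lie below 16, then come the registers of the loops over times, traces, edges
  and window positions. Most frame conditions thus take the form \<open>r < k\<close>.\<close>

abbreviation (input) "rOut \<equiv> 0 :: nat"
abbreviation (input) "rOutLen \<equiv> 1 :: nat"
abbreviation (input) "rT \<equiv> 2 :: nat"
abbreviation (input) "rPtr \<equiv> 3 :: nat"
abbreviation (input) "rEdges \<equiv> 4 :: nat"
abbreviation (input) "rU \<equiv> 5 :: nat"
abbreviation (input) "rV \<equiv> 6 :: nat"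
abbreviation (input) "rLabels \<equiv> 7 :: nat"
abbreviation (input) "rLabel \<equiv> 8 :: nat"
abbreviation (input) "rStride \<equiv> 9 :: nat"
abbreviation (input) "rCentre \<equiv> 10 :: nat"
abbreviation (input) "rSpare \<equiv> 11 :: nat"
abbreviation (input) "rRow \<equiv> 12 :: nat"
abbreviation (input) "rP \<equiv> 13 :: nat"
abbreviation (input) "rQ \<equiv> 14 :: nat"
abbreviation (input) "rInf \<equiv> 15 :: nat"
abbreviation (input) "rOld \<equiv> 16 :: nat"
abbreviation (input) "rW \<equiv> 17 :: nat"
abbreviation (input) "rTime \<equiv> 18 :: nat"
abbreviation (input) "rA \<equiv> 19 :: nat"
abbreviation (input) "rBad \<equiv> 20 :: nat"
abbreviation (input) "rCell \<equiv> 21 :: nat"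
abbreviation (input) "rLeft \<equiv> 22 :: nat"
abbreviation (input) "rR \<equiv> 23 :: nat"
abbreviation (input) "rAddr \<equiv> 24 :: nat"
abbreviation (input) "rAct \<equiv> 25 :: nat"
abbreviation (input) "rHit \<equiv> 26 :: nat"
abbreviation (input) "rI \<equiv> 27 :: nat"
abbreviation (input) "rX \<equiv> 28 :: nat"
abbreviation (input) "rY \<equiv> 29 :: nat"

abbreviation le_exp :: "exp \<Rightarrow> exp \<Rightarrow> exp" where
  "le_exp a b \<equiv> Sub (Add b (Const 1)) a"

abbreviation neq_exp :: "exp \<Rightarrow> exp \<Rightarrow> exp" where
  "neq_exp a b \<equiv> Add (Sub a b) (Sub b a)"

abbreviation decr :: "nat \<Rightarrow> com" where
  "decr r \<equiv> r ::= Sub (Reg r) (Const 1)"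

abbreviation incr :: "nat \<Rightarrow> com" where
  "incr r \<equiv> r ::= Add (Reg r) (Const 1)"

text \<open>A shared skeleton for two passes over the input. The lifetime is not part of the input
  word, yet it fixes the row length of the table, so it must be found before the table is
  filled.\<close>

definition scan_prog :: "com \<Rightarrow> com \<Rightarrow> com" where
  "scan_prog body post =
     (rPtr ::= Const 3 ;; rEdges ::= Mem (Const 1)) ;;
     While (Reg rEdges)
       ((rU ::= Mem (Reg rPtr) ;; rV ::= Mem (Add (Reg rPtr) (Const 1)) ;;
         rLabels ::= Mem (Add (Reg rPtr) (Const 2)) ;; rPtr ::= Add (Reg rPtr) (Const 3)) ;;
        While (Reg rLabels)
          (rLabel ::= Mem (Reg rPtr) ;; body ;; (incr rPtr ;; decr rLabels)) ;;
        post ;;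
        decr rEdges)"

definition lifetime_body :: com where
  "lifetime_body = Cond (Sub (Reg rLabel) (Reg rT)) (rT ::= Reg rLabel) Skip"

text \<open>The first edge active at a time supplies both endpoints as candidates. A later edge that
  avoids the first candidate shows the other one to be the centre.\<close>

definition table_body :: com where
  "table_body =
     Store (Add (Reg rRow) (Reg rLabel)) (Const 1) ;;
     Cond (Mem (Add (Reg rCentre) (Reg rLabel)))
       (Cond (neq_exp (Mem (Add (Reg rCentre) (Reg rLabel))) (Add (Reg rU) (Const 1)))
          (Cond (neq_exp (Mem (Add (Reg rCentre) (Reg rLabel))) (Add (Reg rV) (Const 1)))
             (Store (Add (Reg rCentre) (Reg rLabel)) (Mem (Add (Reg rSpare) (Reg rLabel))))
             Skip)
          Skip)
       (Store (Add (Reg rCentre) (Reg rLabel)) (Add (Reg rU) (Const 1)) ;;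
        Store (Add (Reg rSpare) (Reg rLabel)) (Add (Reg rV) (Const 1)))"

definition table_post :: com where
  "table_post = (rRow ::= Add (Reg rRow) (Reg rStride))"

definition table_init :: com where
  "table_init =
     rStride ::= Add (Reg rT) (Const 1) ;; rCentre ::= Reg rPtr ;;
     rSpare ::= Add (Reg rCentre) (Reg rStride) ;; rRow ::= Add (Reg rSpare) (Reg rStride)"

definition double_prog :: "nat \<Rightarrow> com" where
  "double_prog r = While (Reg rI) (r ::= Add (Reg r) (Reg r) ;; decr rI)"

definition powers_prog :: com where
  "powers_prog =
     (rP ::= Const 1 ;; rI ::= Mem (Const 2)) ;; double_prog rP ;;
     (rQ ::= Const 1 ;; rI ::= Reg rT) ;; double_prog rQ ;;
     (rInf ::= Reg rQ ;; rI ::= Reg rT) ;; double_prog rInf"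

text \<open>Walks back through the window of one edge while doubling a copy of the trace;
  \<open>rAct\<close> counts active times and \<open>rHit\<close> those that are also selected. The
  penalty is assigned rather than added, so several uncovered edges still incur it once.\<close>

definition edge_prog :: com where
  "edge_prog =
     (rR ::= Reg rA ;; rAddr ::= Reg rCell ;; rAct ::= Const 0 ;; rHit ::= Const 0 ;;
      rI ::= Mem (Const 2)) ;;
     While (Reg rI)
       (rAct ::= Add (Reg rAct) (Mem (Reg rAddr)) ;;
        rR ::= Add (Reg rR) (Reg rR) ;;
        Cond (le_exp (Reg rP) (Reg rR))
          (rR ::= Sub (Reg rR) (Reg rP) ;; rHit ::= Add (Reg rHit) (Mem (Reg rAddr)))
          Skip ;;
        decr rAddr ;; decr rI) ;;
     Cond (Reg rHit) Skip (Cond (Reg rAct) (rBad ::= Reg rInf) Skip)"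

definition check_prog :: com where
  "check_prog =
     (rCell ::= Add (Add (Reg rSpare) (Reg rStride)) (Reg rTime) ;; rLeft ::= Mem (Const 1)) ;;
     While (Reg rLeft)
       (edge_prog ;; (rCell ::= Add (Reg rCell) (Reg rStride) ;; decr rLeft))"

text \<open>The new row is written directly behind the old one. Nothing has to be copied back:
  advancing \<open>rOld\<close> by \<open>2 ^ \<Delta>\<close> makes it the old row.\<close>

definition cell_prog :: com where
  "cell_prog =
     rBad ::= Const 0 ;;
     Cond (le_exp (Mem (Const 2)) (Reg rTime)) check_prog Skip ;;
     (rR ::= Add (Reg rA) (Reg rA) ;;
      Cond (le_exp (Reg rP) (Reg rR))
        (rR ::= Sub (Reg rR) (Reg rP) ;; rBad ::= Add (Reg rBad) (Add (Reg rQ) (Reg rW)))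
        Skip ;;
      rX ::= Mem (Add (Reg rOld) (Reg rR)) ;;
      rY ::= Mem (Add (Add (Reg rOld) (Reg rR)) (Const 1)) ;;
      Cond (Sub (Reg rX) (Reg rY)) (rX ::= Reg rY) Skip ;;
      Store (Add (Add (Reg rOld) (Reg rP)) (Reg rA)) (Add (Reg rX) (Reg rBad)))"

definition row_prog :: com where
  "row_prog = rA ::= Const 0 ;; While (Sub (Reg rP) (Reg rA)) (cell_prog ;; incr rA)"

definition dp_prog :: com where
  "dp_prog =
     (rOld ::= Reg rRow ;; rW ::= Const 1 ;; rTime ::= Const 1) ;;
     While (Sub (Reg rStride) (Reg rTime))
       (row_prog ;;
        (rOld ::= Add (Reg rOld) (Reg rP) ;; rW ::= Add (Reg rW) (Reg rW) ;; incr rTime))"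

text \<open>The remainder modulo \<open>2 ^ T\<close> is found by repeated subtraction; this is
  affordable because the quotient is the number of selected times, at most \<open>T\<close>.\<close>

definition pick_prog :: com where
  "pick_prog =
     (rX ::= Mem (Reg rOld) ;; rA ::= Const 0) ;;
     While (Sub (Reg rP) (Reg rA))
       (rY ::= Mem (Add (Reg rOld) (Reg rA)) ;;
        Cond (Sub (Reg rX) (Reg rY)) (rX ::= Reg rY) Skip ;; incr rA) ;;
     While (le_exp (Reg rQ) (Reg rX)) (rX ::= Sub (Reg rX) (Reg rQ))"

text \<open>Bits again leave at the top, so appearances are emitted from the latest time to the
  earliest. The output starts behind the last row of the table.\<close>

definition decode_prog :: com where
  "decode_prog =
     (rOut ::= Add (Reg rOld) (Reg rP) ;; rAddr ::= Reg rOut ;; rTime ::= Reg rT) ;;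
     While (Reg rTime)
       (rX ::= Add (Reg rX) (Reg rX) ;;
        Cond (le_exp (Reg rQ) (Reg rX))
          (rX ::= Sub (Reg rX) (Reg rQ) ;;
           Store (Reg rAddr) (Sub (Mem (Add (Reg rCentre) (Reg rTime))) (Const 1)) ;;
           Store (Add (Reg rAddr) (Const 1)) (Reg rTime) ;;
           rAddr ::= Add (Reg rAddr) (Const 2))
          Skip ;;
        decr rTime) ;;
     rOutLen ::= Sub (Reg rAddr) (Reg rOut)"

definition cover_prog :: com where
  "cover_prog =
     scan_prog lifetime_body Skip ;; (table_init ;; scan_prog table_body table_post) ;;
     powers_prog ;; dp_prog ;; pick_prog ;; decode_prog"

section \<open>Correctness of the dynamic programming phase\<close>

lemma runs_double_prog:
  assumes "r \<noteq> rI"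
  shows "runs (double_prog r) R M (10 * R rI + 2)
    (\<lambda>R' M'. R' = R(r := 2 ^ R rI * R r, rI := 0) \<and> M' = M)"
  unfolding double_prog_def
proof (rule runs_While[where n = "R rI" and K = 8 and
      I = "\<lambda>j R' M'. R' = R(r := 2 ^ j * R r, rI := R rI - j) \<and> M' = M"])
  fix j R' M'
  assume "j < R rI" "R' = R(r := 2 ^ j * R r, rI := R rI - j) \<and> M' = M"
  then show "val (Reg rI) (R', M') \<noteq> 0 \<and>
      runs (r ::= Add (Reg r) (Reg r) ;; decr rI) R' M' 8
        (\<lambda>R' M'. R' = R(r := 2 ^ Suc j * R r, rI := R rI - Suc j) \<and> M' = M)"
    using assms by (auto intro!: runs_wp simp: fun_eq_iff)
qed auto

text \<open>The interface to the reading phase: \<open>M0\<close> is the memory it leaves behind and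
  \<open>N\<close> the input length. The offset \<open>2 + e\<close> skips the two rows of centre
  candidates.\<close>

locale dp_machine =
  fixes m \<Delta> T N :: nat and act :: "nat \<Rightarrow> nat \<Rightarrow> bool" and M0 :: "nat \<Rightarrow> nat"
  assumes \<Delta>: "1 \<le> \<Delta>" "\<Delta> \<le> T" and m: "1 \<le> m" and N: "3 \<le> N"
    and M0_m: "M0 (Suc 0) = m" and M0_\<Delta>: "M0 2 = \<Delta>"
    and M0_act: "\<And>e t. e < m \<Longrightarrow> t \<le> T \<Longrightarrow> M0 (N + (2 + e) * Suc T + t) = of_bool (act e t)"
begin

definition base :: nat where
  "base = N + (2 + m) * Suc T"

definition static :: "(nat \<Rightarrow> nat) \<Rightarrow> (nat \<Rightarrow> nat) \<Rightarrow> bool" where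
  "static R M \<longleftrightarrow> R rT = T \<and> R rStride = Suc T \<and> R rCentre = N \<and> R rSpare = N + Suc T \<and>
     R rP = 2 ^ \<Delta> \<and> R rQ = 2 ^ T \<and> R rInf = 2 ^ T * 2 ^ T \<and> (\<forall>a<base. M a = M0 a)"

text \<open>The frame rule of the remaining phases, which write registers from 16 on, the output
  registers 0 and 1, and memory from \<open>base\<close> on.\<close>

lemma static_cong:
  "static R M \<Longrightarrow> (\<And>r. r < 16 \<Longrightarrow> 2 \<le> r \<Longrightarrow> R' r = R r) \<Longrightarrow> (\<And>a. a < base \<Longrightarrow> M' a = M a) \<Longrightarrow>
    static R' M'"
  by (simp add: static_def)

lemma static_mem:
  assumes "static R M"
  shows "M (Suc 0) = m" "M 2 = \<Delta>"
    "\<And>e t. e < m \<Longrightarrow> t \<le> T \<Longrightarrow> M (N + (2 + e) * Suc T + t) = of_bool (act e t)"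
proof -
  have "2 < base"
    using N by (simp add: base_def)
  then show "M (Suc 0) = m" "M 2 = \<Delta>"
    using assms M0_m M0_\<Delta> by (simp_all add: static_def)
  fix e t assume et: "e < m" "t \<le> T"
  have "(2 + e) * Suc T + Suc T \<le> (2 + m) * Suc T"
    using et(1) mult_le_mono1[of "2 + e + 1" "2 + m" "Suc T"] by simp
  then have "N + (2 + e) * Suc T + t < base"
    unfolding base_def using et(2) by linarith
  then show "M (N + (2 + e) * Suc T + t) = of_bool (act e t)"
    using assms M0_act et by (simp add: static_def)
qed

lemma runs_edge_prog:
  assumes st: "static R M" and e: "e < m" and t: "\<Delta> \<le> t" "t \<le> T"
    and A: "R rA < 2 ^ \<Delta>" and cell: "R rCell = N + (2 + e) * Suc T + t"
  shows "runs edge_prog R M (80 * \<Delta>) (\<lambda>R' M'. M' = M \<and> (\<forall>r<23. r \<noteq> rBad \<longrightarrow> R' r = R r) \<and>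
    R' rBad = (if uncovered act \<Delta> t (R rA) e then 2 ^ T * 2 ^ T else R rBad))"
proof -
  have regs: "R rP = 2 ^ \<Delta>" "R rInf = 2 ^ T * 2 ^ T"
    using st by (simp_all add: static_def)
  \<comment> \<open>The two counters are tracked only up to positivity, which is all that the final
    test inspects.\<close>
  define I where "I = (\<lambda>j R' M'. M' = M \<and> (\<forall>r<23. R' r = R r) \<and> R' rR = doubled \<Delta> j (R rA) \<and>
    R' rAddr = R rCell - j \<and> (0 < R' rAct \<longleftrightarrow> (\<exists>i<j. act e (t - i))) \<and>
    (0 < R' rHit \<longleftrightarrow> (\<exists>i<j. act e (t - i) \<and> nth_newest \<Delta> i (R rA))) \<and> R' rI = \<Delta> - j)"
  have step: "val (Reg rI) (R', M') \<noteq> 0 \<and>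
      runs (rAct ::= Add (Reg rAct) (Mem (Reg rAddr)) ;;
        rR ::= Add (Reg rR) (Reg rR) ;;
        Cond (le_exp (Reg rP) (Reg rR))
          (rR ::= Sub (Reg rR) (Reg rP) ;; rHit ::= Add (Reg rHit) (Mem (Reg rAddr)))
          Skip ;;
        decr rAddr ;; decr rI) R' M' 40 (I (Suc j))" if j: "j < \<Delta>" and I: "I j R' M'" for j R' M'
  proof -
    have "R rCell - j = N + (2 + e) * Suc T + (t - j)"
      using j t cell by simp
    then have "M (R rCell - j) = of_bool (act e (t - j))"
      using static_mem(3)[OF st e, of "t - j"] t by simp
    with I j regs show ?thesis
      by (auto intro!: runs_wp simp: I_def doubled_Suc nth_newest_def less_Suc_eq
          Ex_less_Suc)
  qed
  show ?thesis
    unfolding edge_prog_def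
  proof (rule runs_Seq[where ?Q1.0 = "I 0" and ?K1.0 = 20])
    show "runs (rR ::= Reg rA ;; rAddr ::= Reg rCell ;; rAct ::= Const 0 ;; rHit ::= Const 0 ;;
      rI ::= Mem (Const 2)) R M 20 (I 0)"
      using A static_mem(2)[OF st] by (auto intro!: runs_wp simp: I_def doubled_0)
    fix R1 M1 assume I0: "I 0 R1 M1"
    show "runs (While (Reg rI)
       (rAct ::= Add (Reg rAct) (Mem (Reg rAddr)) ;;
        rR ::= Add (Reg rR) (Reg rR) ;;
        Cond (le_exp (Reg rP) (Reg rR))
          (rR ::= Sub (Reg rR) (Reg rP) ;; rHit ::= Add (Reg rHit) (Mem (Reg rAddr)))
          Skip ;;
        decr rAddr ;; decr rI) ;;
     Cond (Reg rHit) Skip (Cond (Reg rAct) (rBad ::= Reg rInf) Skip)) R1 M1 (42 * \<Delta> + 12)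
      (\<lambda>R' M'. M' = M \<and> (\<forall>r<23. r \<noteq> rBad \<longrightarrow> R' r = R r) \<and>
        R' rBad = (if uncovered act \<Delta> t (R rA) e then 2 ^ T * 2 ^ T else R rBad))"
    proof (rule runs_Seq[where ?Q1.0 = "I \<Delta>" and ?K1.0 = "42 * \<Delta> + 2" and ?K2.0 = 10])
      show "runs (While (Reg rI)
       (rAct ::= Add (Reg rAct) (Mem (Reg rAddr)) ;;
        rR ::= Add (Reg rR) (Reg rR) ;;
        Cond (le_exp (Reg rP) (Reg rR))
          (rR ::= Sub (Reg rR) (Reg rP) ;; rHit ::= Add (Reg rHit) (Mem (Reg rAddr)))
          Skip ;;
        decr rAddr ;; decr rI)) R1 M1 (42 * \<Delta> + 2) (I \<Delta>)"
        by (rule runs_While[where I = I and n = \<Delta> and K = 40, OF I0 step]) (auto simp: I_def)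
    next
      fix R2 M2 assume "I \<Delta> R2 M2"
      then show "runs (Cond (Reg rHit) Skip (Cond (Reg rAct) (rBad ::= Reg rInf) Skip)) R2 M2 10
       (\<lambda>R' M'. M' = M \<and> (\<forall>r<23. r \<noteq> rBad \<longrightarrow> R' r = R r) \<and>
        R' rBad = (if uncovered act \<Delta> t (R rA) e then 2 ^ T * 2 ^ T else R rBad))"
        using regs by (intro runs_wp) (auto simp: I_def uncovered_def)
    qed simp
  qed (use \<Delta> in simp)
qed

lemma runs_check_prog:
  assumes st: "static R M" and t: "\<Delta> \<le> R rTime" "R rTime \<le> T"
    and A: "R rA < 2 ^ \<Delta>" and bad: "R rBad = 0"
  shows "runs check_prog R M (120 * (m * \<Delta>)) (\<lambda>R' M'. M' = M \<and> (\<forall>r<20. R' r = R r) \<and>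
    R' rBad = penalty m act \<Delta> T (R rTime) (R rA))"
proof -
  define I where "I = (\<lambda>j R' M'. M' = M \<and> (\<forall>r<20. R' r = R r) \<and>
    R' rBad = (if \<exists>e<j. uncovered act \<Delta> (R rTime) (R rA) e then 2 ^ T * 2 ^ T else 0) \<and>
    R' rCell = N + (2 + j) * Suc T + R rTime \<and> R' rLeft = m - j)"
  have step: "val (Reg rLeft) (R', M') \<noteq> 0 \<and>
      runs (edge_prog ;; (rCell ::= Add (Reg rCell) (Reg rStride) ;; decr rLeft)) R' M'
        (80 * \<Delta> + 10) (I (Suc j))" if j: "j < m" and I: "I j R' M'" for j R' M'
  proof
    show "val (Reg rLeft) (R', M') \<noteq> 0"
      using I j by (simp add: I_def)
    have st': "static R' M'"
      using st by (rule static_cong) (use I in \<open>auto simp: I_def\<close>)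
    show "runs (edge_prog ;; (rCell ::= Add (Reg rCell) (Reg rStride) ;; decr rLeft)) R' M'
        (80 * \<Delta> + 10) (I (Suc j))"
    proof (rule runs_Seq[OF runs_edge_prog[OF st' j t]])
      show "R' rA < 2 ^ \<Delta>" "R' rCell = N + (2 + j) * Suc T + R rTime"
        using I A by (auto simp: I_def)
      fix R2 M2
      assume "M2 = M' \<and> (\<forall>r<23. r \<noteq> rBad \<longrightarrow> R2 r = R' r) \<and>
        R2 rBad = (if uncovered act \<Delta> (R rTime) (R' rA) j then 2 ^ T * 2 ^ T else R' rBad)"
      then show "runs (rCell ::= Add (Reg rCell) (Reg rStride) ;; decr rLeft) R2 M2 10 (I (Suc j))"
        using I st by (intro runs_wp) (auto simp: I_def static_def less_Suc_eq)
    qed simp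
  qed
  show ?thesis
    unfolding check_prog_def
  proof (rule runs_Seq[where ?Q1.0 = "I 0" and ?K1.0 = 10])
    show "runs (rCell ::= Add (Add (Reg rSpare) (Reg rStride)) (Reg rTime) ;;
        rLeft ::= Mem (Const 1)) R M 10 (I 0)"
      using st bad static_mem(1)[OF st] by (intro runs_wp) (auto simp: I_def static_def)
    show "runs (While (Reg rLeft)
       (edge_prog ;; (rCell ::= Add (Reg rCell) (Reg rStride) ;; decr rLeft))) R1 M1
       (m * (80 * \<Delta> + 12) + 2) (\<lambda>R' M'. M' = M \<and> (\<forall>r<20. R' r = R r) \<and>
    R' rBad = penalty m act \<Delta> T (R rTime) (R rA))" if "I 0 R1 M1" for R1 M1
      by (rule runs_While[where I = I and n = m, OF that step])
        (use t in \<open>auto simp: I_def penalty_def algebra_simps\<close>)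
    \<comment> \<open>Lower-order terms are absorbed using \<open>m \<ge> 1\<close> and
      \<open>\<Delta> \<ge> 1\<close>; the bounds of the enclosing loops are closed in the same
      way.\<close>
    have "m \<le> m * \<Delta>" "1 \<le> m * \<Delta>"
      using \<Delta> m by auto
    moreover have "m * (80 * \<Delta> + 12) = 80 * (m * \<Delta>) + 12 * m"
      by (simp add: algebra_simps)
    ultimately show "10 + (m * (80 * \<Delta> + 12) + 2) \<le> 120 * (m * \<Delta>)"
      by linarith
  qed
qed

lemma runs_cell_prog:
  assumes st: "static R M" and t: "1 \<le> R rTime" "R rTime \<le> T" and A: "R rA < 2 ^ \<Delta>"
    and w: "R rW = 2 ^ (R rTime - 1)"
    and old: "\<And>B. B < 2 ^ \<Delta> \<Longrightarrow> M (R rOld + B) = dp_row m act \<Delta> T (R rTime - 1) B"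
  shows "runs cell_prog R M (210 * (m * \<Delta>)) (\<lambda>R' M'. (\<forall>r<20. R' r = R r) \<and>
    M' = M(R rOld + 2 ^ \<Delta> + R rA := dp_row m act \<Delta> T (R rTime) (R rA)))"
proof -
  obtain s where s: "R rTime = Suc s"
    using t(1) by (cases "R rTime") auto
  have regs: "R rP = 2 ^ \<Delta>" "R rQ = 2 ^ T" "M 2 = \<Delta>"
    using st static_mem[OF st] by (simp_all add: static_def)
  have "1 \<le> m * \<Delta>"
    using \<Delta> m by simp
  then have le: "120 * (m * \<Delta>) + 90 \<le> 210 * (m * \<Delta>)"
    by linarith
  let ?B = "doubled \<Delta> 1 (R rA)"
  have M: "M (R rOld + ?B) = dp_row m act \<Delta> T s ?B"
      "M (R rOld + (?B + 1)) = dp_row m act \<Delta> T s (?B + 1)"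
    using old[of ?B] old[of "?B + 1"] doubled_less[of \<Delta> 1 "R rA"]
      doubled_1_Suc_less[OF \<Delta>(1), of "R rA"] s by simp_all
  \<comment> \<open>The overflow test of the doubling is also the test whether the current time is
    selected, so one branch both forms the predecessor and charges the selection.\<close>
  have B: "?B = (if 2 ^ \<Delta> \<le> R rA + R rA then R rA + R rA - 2 ^ \<Delta> else R rA + R rA)"
    using doubled_1[OF A] by (simp add: mult_2)
  have row: "dp_row m act \<Delta> T (R rTime) (R rA) =
      min (M (R rOld + ?B)) (M (Suc (R rOld + ?B))) +
      ((if 2 ^ \<Delta> \<le> R rA + R rA then 2 ^ T + R rW else 0) + penalty m act \<Delta> T (R rTime) (R rA))"
    using M w by (simp add: s local_cost_def mult_2)
  show ?thesis
    unfolding cell_prog_def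
  proof (rule runs_Seq[where ?K1.0 = 2])
    show "runs (rBad ::= Const 0) R M 2 (\<lambda>R' M'. R' = R(rBad := 0) \<and> M' = M)"
      by (rule runs_wp) simp_all
    fix R1 M1 assume 1: "R1 = R(rBad := 0) \<and> M1 = M"
    have st1: "static R1 M1"
      using st by (rule static_cong) (use 1 in auto)
    let ?Q = "\<lambda>R' M'. M' = M \<and> (\<forall>r<20. R' r = R r) \<and>
        R' rBad = penalty m act \<Delta> T (R rTime) (R rA)"
    show "runs (Cond (le_exp (Mem (Const 2)) (Reg rTime)) check_prog Skip ;;
     (rR ::= Add (Reg rA) (Reg rA) ;;
      Cond (le_exp (Reg rP) (Reg rR))
        (rR ::= Sub (Reg rR) (Reg rP) ;; rBad ::= Add (Reg rBad) (Add (Reg rQ) (Reg rW)))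
        Skip ;;
      rX ::= Mem (Add (Reg rOld) (Reg rR)) ;;
      rY ::= Mem (Add (Add (Reg rOld) (Reg rR)) (Const 1)) ;;
      Cond (Sub (Reg rX) (Reg rY)) (rX ::= Reg rY) Skip ;;
      Store (Add (Add (Reg rOld) (Reg rP)) (Reg rA)) (Add (Reg rX) (Reg rBad)))) R1 M1
      (120 * (m * \<Delta>) + 80) (\<lambda>R' M'. (\<forall>r<20. R' r = R r) \<and>
    M' = M(R rOld + 2 ^ \<Delta> + R rA := dp_row m act \<Delta> T (R rTime) (R rA)))"
    proof (rule runs_Seq[where ?Q1.0 = ?Q and ?K1.0 = "120 * (m * \<Delta>) + 10" and ?K2.0 = 70])
      show "runs (Cond (le_exp (Mem (Const 2)) (Reg rTime)) check_prog Skip) R1 M1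
          (120 * (m * \<Delta>) + 10) ?Q"
      proof (rule runs_Cond[where ?K1.0 = "120 * (m * \<Delta>) + 1"])
        assume "val (le_exp (Mem (Const 2)) (Reg rTime)) (R1, M1) \<noteq> 0"
        then have "\<Delta> \<le> R1 rTime"
          using regs 1 by simp
        then show "runs check_prog R1 M1 (120 * (m * \<Delta>) + 1) ?Q"
          using t A 1 by (intro runs_conseq[OF runs_check_prog[OF st1]]) auto
      next
        assume "val (le_exp (Mem (Const 2)) (Reg rTime)) (R1, M1) = 0"
        then have "\<not> \<Delta> \<le> R rTime"
          using regs 1 by simp
        then show "runs Skip R1 M1 (120 * (m * \<Delta>) + 1) ?Q"
          using 1 by (intro runs_wp) (auto simp: penalty_def)
      qed simp
      fix R2 M2 assume "?Q R2 M2"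
      then show "runs (rR ::= Add (Reg rA) (Reg rA) ;;
      Cond (le_exp (Reg rP) (Reg rR))
        (rR ::= Sub (Reg rR) (Reg rP) ;; rBad ::= Add (Reg rBad) (Add (Reg rQ) (Reg rW)))
        Skip ;;
      rX ::= Mem (Add (Reg rOld) (Reg rR)) ;;
      rY ::= Mem (Add (Add (Reg rOld) (Reg rR)) (Const 1)) ;;
      Cond (Sub (Reg rX) (Reg rY)) (rX ::= Reg rY) Skip ;;
      Store (Add (Add (Reg rOld) (Reg rP)) (Reg rA)) (Add (Reg rX) (Reg rBad))) R2 M2 70
      (\<lambda>R' M'. (\<forall>r<20. R' r = R r) \<and>
    M' = M(R rOld + 2 ^ \<Delta> + R rA := dp_row m act \<Delta> T (R rTime) (R rA)))"
        using regs unfolding row B by (intro runs_wp) (auto simp: min_def add.assoc)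
    qed simp
  qed (use le in linarith)
qed

lemma runs_row_prog:
  assumes st: "static R M" and t: "1 \<le> R rTime" "R rTime \<le> T"
    and w: "R rW = 2 ^ (R rTime - 1)" and base: "base \<le> R rOld"
    and old: "\<And>B. B < 2 ^ \<Delta> \<Longrightarrow> M (R rOld + B) = dp_row m act \<Delta> T (R rTime - 1) B"
  shows "runs row_prog R M (230 * (2 ^ \<Delta> * (m * \<Delta>))) (\<lambda>R' M'. (\<forall>r<19. R' r = R r) \<and>
    (\<forall>a<base. M' a = M a) \<and>
    (\<forall>B<2 ^ \<Delta>. M' (R rOld + 2 ^ \<Delta> + B) = dp_row m act \<Delta> T (R rTime) B))"
proof -
  have regs: "R rP = 2 ^ \<Delta>"
    using st by (simp add: static_def)
  \<comment> \<open>The unchanged region extends to the end of the old row, since every later cell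
    of the new row still reads from it.\<close>
  define I where "I = (\<lambda>j R' M'. (\<forall>r<19. R' r = R r) \<and> R' rA = j \<and>
    (\<forall>a<R rOld + 2 ^ \<Delta>. M' a = M a) \<and>
    (\<forall>B<j. M' (R rOld + 2 ^ \<Delta> + B) = dp_row m act \<Delta> T (R rTime) B))"
  have step: "val (Sub (Reg rP) (Reg rA)) (R', M') \<noteq> 0 \<and>
      runs (cell_prog ;; incr rA) R' M' (210 * (m * \<Delta>) + 4) (I (Suc j))"
    if j: "j < 2 ^ \<Delta>" and I: "I j R' M'" for j R' M'
  proof
    show "val (Sub (Reg rP) (Reg rA)) (R', M') \<noteq> 0"
      using I j regs by (simp add: I_def)
    have st': "static R' M'"
      using st by (rule static_cong) (use I base in \<open>auto simp: I_def\<close>)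
    show "runs (cell_prog ;; incr rA) R' M' (210 * (m * \<Delta>) + 4) (I (Suc j))"
    proof (rule runs_Seq[OF runs_cell_prog[OF st']])
      fix B assume B: "B < (2::nat) ^ \<Delta>"
      then show "M' (R' rOld + B) = dp_row m act \<Delta> T (R' rTime - 1) B"
        using I old[OF B] by (simp add: I_def)
    next
      fix R2 M2
      assume "(\<forall>r<20. R2 r = R' r) \<and>
        M2 = M'(R' rOld + 2 ^ \<Delta> + R' rA := dp_row m act \<Delta> T (R' rTime) (R' rA))"
      then show "runs (incr rA) R2 M2 4 (I (Suc j))"
        using I by (intro runs_wp) (auto simp: I_def less_Suc_eq)
    qed (use I t w j in \<open>auto simp: I_def\<close>)
  qed
  show ?thesis
    unfolding row_prog_def
  proof (rule runs_Seq[where ?Q1.0 = "I 0" and ?K1.0 = 2])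
    show "runs (rA ::= Const 0) R M 2 (I 0)"
      by (rule runs_wp) (auto simp: I_def)
    show "runs (While (Sub (Reg rP) (Reg rA)) (cell_prog ;; incr rA)) R1 M1
        (2 ^ \<Delta> * (210 * (m * \<Delta>) + 8) + 4)
        (\<lambda>R' M'. (\<forall>r<19. R' r = R r) \<and> (\<forall>a<base. M' a = M a) \<and>
          (\<forall>B<2 ^ \<Delta>. M' (R rOld + 2 ^ \<Delta> + B) = dp_row m act \<Delta> T (R rTime) B))"
      if "I 0 R1 M1" for R1 M1
      by (rule runs_While[where I = I and n = "2 ^ \<Delta>", OF that step])
        (use base regs in \<open>auto simp: I_def\<close>)
    have "(2::nat) ^ \<Delta> * 1 \<le> 2 ^ \<Delta> * (m * \<Delta>)"
      using \<Delta> m by (intro mult_le_mono2) simp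
    moreover have "1 \<le> (2::nat) ^ \<Delta>"
      by simp
    moreover have "2 ^ \<Delta> * (210 * (m * \<Delta>) + 8) = 210 * (2 ^ \<Delta> * (m * \<Delta>)) + 2 ^ \<Delta> * 8"
      by (simp add: algebra_simps)
    ultimately show "2 + (2 ^ \<Delta> * (210 * (m * \<Delta>) + 8) + 4) \<le> 230 * (2 ^ \<Delta> * (m * \<Delta>))"
      by linarith
  qed
qed

text \<open>Untouched memory from \<open>base\<close> on is zero and serves as the row of time 0
  without being initialised.\<close>

lemma runs_dp_prog:
  assumes st: "static R M" and row: "R rRow = base" and zero: "\<And>a. base \<le> a \<Longrightarrow> M a = 0"
  shows "runs dp_prog R M (270 * (T * (2 ^ \<Delta> * (m * \<Delta>)))) (\<lambda>R' M'. static R' M' \<and>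
    base \<le> R' rOld \<and> (\<forall>B<2 ^ \<Delta>. M' (R' rOld + B) = dp_row m act \<Delta> T T B))"
proof -
  define I where "I = (\<lambda>j R' M'. static R' M' \<and> base \<le> R' rOld \<and> R' rW = 2 ^ j \<and> R' rTime = Suc j \<and>
    (\<forall>B<2 ^ \<Delta>. M' (R' rOld + B) = dp_row m act \<Delta> T j B))"
  define K where "K = 2 ^ \<Delta> * (m * \<Delta>)"
  have step: "val (Sub (Reg rStride) (Reg rTime)) (R', M') \<noteq> 0 \<and>
      runs (row_prog ;;
        (rOld ::= Add (Reg rOld) (Reg rP) ;; rW ::= Add (Reg rW) (Reg rW) ;; incr rTime))
        R' M' (230 * K + 20) (I (Suc j))"
    if j: "j < T" and I: "I j R' M'" for j R' M'
  proof
    show "val (Sub (Reg rStride) (Reg rTime)) (R', M') \<noteq> 0"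
      using I j by (simp add: I_def static_def)
    show "runs (row_prog ;;
        (rOld ::= Add (Reg rOld) (Reg rP) ;; rW ::= Add (Reg rW) (Reg rW) ;; incr rTime))
        R' M' (230 * K + 20) (I (Suc j))"
    proof (rule runs_Seq[OF runs_row_prog, folded K_def])
      fix R2 M2
      assume 2: "(\<forall>r<19. R2 r = R' r) \<and> (\<forall>a<base. M2 a = M' a) \<and>
        (\<forall>B<2 ^ \<Delta>. M2 (R' rOld + 2 ^ \<Delta> + B) = dp_row m act \<Delta> T (R' rTime) B)"
      moreover have "static R2 M2"
        by (rule static_cong[of R' M']) (use I 2 in \<open>auto simp: I_def\<close>)
      then have "static (R2(rOld := x, rW := y, rTime := z)) M2" for x y z
        by (rule static_cong) auto
      moreover have "R' rP = 2 ^ \<Delta>"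
        using I by (simp add: I_def static_def)
      ultimately show "runs (rOld ::= Add (Reg rOld) (Reg rP) ;; rW ::= Add (Reg rW) (Reg rW) ;;
          incr rTime) R2 M2 20 (I (Suc j))"
        using I by (intro runs_wp) (auto simp: I_def)
    qed (use I j in \<open>auto simp: I_def\<close>)
  qed
  show ?thesis
    unfolding dp_prog_def K_def[symmetric]
  proof (rule runs_Seq[where ?Q1.0 = "I 0" and ?K1.0 = 10])
    have "static (R(rOld := x, rW := y, rTime := z)) M" for x y z
      using st by (rule static_cong) auto
    then show "runs (rOld ::= Reg rRow ;; rW ::= Const 1 ;; rTime ::= Const 1) R M 10 (I 0)"
      using row zero by (intro runs_wp) (auto simp: I_def)
    show "runs (While (Sub (Reg rStride) (Reg rTime))
       (row_prog ;;
        (rOld ::= Add (Reg rOld) (Reg rP) ;; rW ::= Add (Reg rW) (Reg rW) ;; incr rTime))) R1 M1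
        (T * (230 * K + 24) + 4)
        (\<lambda>R' M'. static R' M' \<and> base \<le> R' rOld \<and>
          (\<forall>B<2 ^ \<Delta>. M' (R' rOld + B) = dp_row m act \<Delta> T T B))"
      if "I 0 R1 M1" for R1 M1
      by (rule runs_While[where I = I and n = T, OF that step])
        (auto simp: I_def static_def)
    have "T * 1 \<le> T * K"
      unfolding K_def using \<Delta> m by (intro mult_le_mono2) simp
    moreover have "1 \<le> T"
      using \<Delta> by simp
    moreover have "T * (230 * K + 24) = 230 * (T * K) + T * 24"
      by (simp add: algebra_simps)
    ultimately show "10 + (T * (230 * K + 24) + 4) \<le> 270 * (T * K)"
      by linarith
  qed
qed

lemma runs_pick_prog:
  assumes st: "static R M"
    and row: "\<And>B. B < 2 ^ \<Delta> \<Longrightarrow> M (R rOld + B) = dp_row m act \<Delta> T T B"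
  shows "runs pick_prog R M (30 * 2 ^ \<Delta> + 20 * T + 30) (\<lambda>R' M'. M' = M \<and>
    (\<forall>r<19. R' r = R r) \<and>
    (\<exists>X. good_times m act \<Delta> T X \<and> (\<forall>Y. good_times m act \<Delta> T Y \<longrightarrow> card X \<le> card Y) \<and>
      R' rX = time_code X))"
proof -
  have regs: "R rP = 2 ^ \<Delta>" "R rQ = 2 ^ T"
    using st by (simp_all add: static_def)
  define I where "I = (\<lambda>j R' M'. M' = M \<and> (\<forall>r<19. R' r = R r) \<and> R' rA = j \<and>
    (\<forall>B<j. R' rX \<le> dp_row m act \<Delta> T T B) \<and>
    (\<exists>B<2 ^ \<Delta>. R' rX = dp_row m act \<Delta> T T B))"
  have step: "val (Sub (Reg rP) (Reg rA)) (R', M') \<noteq> 0 \<and>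
      runs (rY ::= Mem (Add (Reg rOld) (Reg rA)) ;;
        Cond (Sub (Reg rX) (Reg rY)) (rX ::= Reg rY) Skip ;; incr rA) R' M' 20 (I (Suc j))"
    if j: "j < 2 ^ \<Delta>" and I: "I j R' M'" for j R' M'
  proof -
    have "I (Suc j) (R'(rY := dp_row m act \<Delta> T T j, rX := dp_row m act \<Delta> T T j, rA := Suc j)) M'"
      if "dp_row m act \<Delta> T T j < R' rX"
      using that I j unfolding I_def by (fastforce simp: less_Suc_eq)
    moreover have "I (Suc j) (R'(rY := dp_row m act \<Delta> T T j, rA := Suc j)) M'"
      if "\<not> dp_row m act \<Delta> T T j < R' rX"
      using that I j unfolding I_def by (fastforce simp: less_Suc_eq)
    moreover have "R' rA = j" "R' rP = 2 ^ \<Delta>" "M' (R' rOld + R' rA) = dp_row m act \<Delta> T T j"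
      using I row[OF j] regs by (auto simp: I_def)
    ultimately show ?thesis
      using j by (auto intro!: runs_wp)
  qed
  \<comment> \<open>Between the two loops \<open>rX\<close> holds the whole optimal value; the
    second loop strips the counting part.\<close>
  define J where "J = (\<lambda>R' M'. M' = M \<and> (\<forall>r<19. R' r = R r) \<and>
    (\<exists>X. good_times m act \<Delta> T X \<and> (\<forall>Y. good_times m act \<Delta> T Y \<longrightarrow> card X \<le> card Y) \<and>
      R' rX = 2 ^ T * card X + time_code X))"
  have loop: "runs (While (le_exp (Reg rQ) (Reg rX)) (rX ::= Sub (Reg rX) (Reg rQ))) R2 M2
      (10 * T + 6) (\<lambda>R' M'. M' = M \<and> (\<forall>r<19. R' r = R r) \<and>
        (\<exists>X. good_times m act \<Delta> T X \<and> (\<forall>Y. good_times m act \<Delta> T Y \<longrightarrow> card X \<le> card Y) \<and>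
          R' rX = time_code X))"
    if J: "J R2 M2" for R2 M2
  proof -
    obtain X where X: "good_times m act \<Delta> T X" "\<forall>Y. good_times m act \<Delta> T Y \<longrightarrow> card X \<le> card Y"
        "R2 rX = 2 ^ T * card X + time_code X"
      using J by (auto simp: J_def)
    have XT: "X \<subseteq> {1..T}"
      using X by (simp add: good_times_def)
    then have "card X \<le> T"
      using card_mono[of "{1..T}" X] by simp
    have "time_code X < 2 ^ T"
      using XT by (rule time_code_less)
    \<comment> \<open>Each subtraction removes one unit of the count, and what remains after
      \<open>card X\<close> of them is below \<open>2 ^ T\<close>, so the loop stops exactly
      there.\<close>
    show ?thesis
    proof (rule runs_While[where n = "card X" and K = 4 and
          I = "\<lambda>j R' M'. M' = M \<and> (\<forall>r<19. R' r = R r) \<and>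
            R' rX = 2 ^ T * (card X - j) + time_code X"])
      fix j R' M'
      assume j: "j < card X" and I: "M' = M \<and> (\<forall>r<19. R' r = R r) \<and>
            R' rX = 2 ^ T * (card X - j) + time_code X"
      have "card X - j = Suc (card X - Suc j)"
        using j by simp
      then have "R' rX = 2 ^ T * (card X - Suc j) + time_code X + 2 ^ T"
        using I by simp
      then show "val (le_exp (Reg rQ) (Reg rX)) (R', M') \<noteq> 0 \<and>
          runs (rX ::= Sub (Reg rX) (Reg rQ)) R' M' 4 (\<lambda>R' M'. M' = M \<and> (\<forall>r<19. R' r = R r) \<and>
            R' rX = 2 ^ T * (card X - Suc j) + time_code X)"
        using I regs by (auto intro!: runs_wp)
    qed (use J X regs \<open>card X \<le> T\<close> \<open>time_code X < 2 ^ T\<close> in \<open>auto simp: J_def\<close>)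
  qed
  show ?thesis
    unfolding pick_prog_def
  proof (rule runs_Seq[where ?Q1.0 = "I 0" and ?K1.0 = 10])
    show "runs (rX ::= Mem (Reg rOld) ;; rA ::= Const 0) R M 10 (I 0)"
      using row[of 0] by (intro runs_wp) (auto simp: I_def intro: exI[of _ 0])
    fix R1 M1 assume I0: "I 0 R1 M1"
    have exit: "val (Sub (Reg rP) (Reg rA)) (R', M') = 0 \<and> J R' M'"
      if I: "I (2 ^ \<Delta>) R' M'" for R' M'
    proof -
      obtain B where B: "B < 2 ^ \<Delta>" "R' rX = dp_row m act \<Delta> T T B"
        using I by (auto simp: I_def)
      have opt: "\<exists>X. good_times m act \<Delta> T X \<and> R' rX = 2 ^ T * card X + time_code X \<and>
          (\<forall>Y. good_times m act \<Delta> T Y \<longrightarrow> card X \<le> card Y)"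
        by (rule dp_optimum[OF \<Delta>(1) _ B]) (use I in \<open>simp add: I_def\<close>)
      have "val (Sub (Reg rP) (Reg rA)) (R', M') = 0" "M' = M" "\<forall>r<19. R' r = R r"
        using I regs by (auto simp: I_def)
      with opt show ?thesis
        unfolding J_def by blast
    qed
    show "runs (While (Sub (Reg rP) (Reg rA))
       (rY ::= Mem (Add (Reg rOld) (Reg rA)) ;;
        Cond (Sub (Reg rX) (Reg rY)) (rX ::= Reg rY) Skip ;; incr rA) ;;
     While (le_exp (Reg rQ) (Reg rX)) (rX ::= Sub (Reg rX) (Reg rQ))) R1 M1
     ((2 ^ \<Delta> * 24 + 4) + (10 * T + 6)) (\<lambda>R' M'. M' = M \<and> (\<forall>r<19. R' r = R r) \<and>
        (\<exists>X. good_times m act \<Delta> T X \<and> (\<forall>Y. good_times m act \<Delta> T Y \<longrightarrow> card X \<le> card Y) \<and>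
          R' rX = time_code X))"
      by (rule runs_Seq[OF runs_While[where I = I and Q = J and n = "2 ^ \<Delta>" and K = 20
              and K' = "2 ^ \<Delta> * 24 + 4", OF I0 step exit] loop]) (assumption | simp)+
  qed simp
qed

text \<open>After \<open>j\<close> rounds the \<open>j\<close> latest times have left the register
  and the rest of the code is scaled by \<open>2 ^ j\<close>, so the next doubling exceeds
  \<open>2 ^ T\<close> exactly when time \<open>T - j\<close> is selected.\<close>

lemma runs_decode_prog:
  assumes st: "static R M" and base: "base \<le> R rOld"
    and X: "X \<subseteq> {1..T}" "R rX = time_code X"
  shows "runs decode_prog R M (50 * T + 30) (\<lambda>R' M'. output_word (R', M') =
    concat (map (\<lambda>(v, t). [v, t])
      (map (\<lambda>t. (M0 (N + t) - 1, t)) (filter (\<lambda>t. t \<in> X) (rev [1..<Suc T])))))"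
proof -
  have regs: "R rP = 2 ^ \<Delta>" "R rQ = 2 ^ T" "R rT = T" "R rCentre = N"
    using st by (simp_all add: static_def)
  define out where "out = R rOld + 2 ^ \<Delta>"
  \<comment> \<open>The part of the output that belongs to times greater than
    \<open>k\<close>.\<close>
  define ws where "ws = (\<lambda>k. concat (map (\<lambda>(v, t). [v, t])
      (map (\<lambda>t. (M0 (N + t) - 1, t)) (filter (\<lambda>t. t \<in> X) (rev [Suc k..<Suc T])))))"
  have ws_Suc: "ws k = ws (Suc k) @ (if Suc k \<in> X then [M0 (N + Suc k) - 1, Suc k] else [])"
    if "k < T" for k
    using that by (simp add: ws_def upt_conv_Cons del: upt_Suc)
  have code_Suc: "time_code (X \<inter> {1..Suc k}) =
      time_code (X \<inter> {1..k}) + (if Suc k \<in> X then 2 ^ k else 0)" for k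
  proof -
    have "X \<inter> {1..Suc k} = (if Suc k \<in> X then insert (Suc k) (X \<inter> {1..k}) else X \<inter> {1..k})"
      by (auto simp: le_Suc_eq)
    then show ?thesis
      by (simp add: time_code_def)
  qed
  define I where "I = (\<lambda>j R' M'. R' rQ = 2 ^ T \<and> R' rCentre = N \<and> R' rOut = out \<and>
    R' rTime = T - j \<and> R' rX = 2 ^ j * time_code (X \<inter> {1..T - j}) \<and>
    (\<forall>a<out. M' a = M a) \<and> R' rAddr = out + length (ws (T - j)) \<and>
    map M' [out..<out + length (ws (T - j))] = ws (T - j))"
  have step: "val (Reg rTime) (R', M') \<noteq> 0 \<and>
      runs (rX ::= Add (Reg rX) (Reg rX) ;;
        Cond (le_exp (Reg rQ) (Reg rX))
          (rX ::= Sub (Reg rX) (Reg rQ) ;;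
           Store (Reg rAddr) (Sub (Mem (Add (Reg rCentre) (Reg rTime))) (Const 1)) ;;
           Store (Add (Reg rAddr) (Const 1)) (Reg rTime) ;;
           rAddr ::= Add (Reg rAddr) (Const 2))
          Skip ;;
        decr rTime) R' M' 46 (I (Suc j))"
    if j: "j < T" and I: "I j R' M'" for j R' M'
  proof -
    define k where "k = T - Suc j"
    have k: "T - j = Suc k" "k < T" "T - Suc j = k"
      using j by (auto simp: k_def)
    have "T = Suc j + k"
      using j by (simp add: k_def)
    then have T: "(2::nat) ^ T = 2 ^ Suc j * 2 ^ k"
      by (simp only: power_add)
    have "time_code (X \<inter> {1..k}) < 2 ^ k"
      by (rule time_code_less) auto
    then have low: "2 ^ Suc j * time_code (X \<inter> {1..k}) < 2 ^ T"
      unfolding T by simp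
    have dbl: "R' rX + R' rX =
        2 ^ Suc j * time_code (X \<inter> {1..k}) + (if Suc k \<in> X then 2 ^ T else 0)"
      using I unfolding I_def k code_Suc T by (simp add: algebra_simps)
    \<comment> \<open>This places the centre row below \<open>base\<close>, hence below the output
      area, so the centres read are still the original ones.\<close>
    have "2 \<le> Suc (Suc m) * Suc T"
      by simp
    moreover have "Suc (Suc m) * Suc T = Suc T + Suc T + m * Suc T"
      by simp
    ultimately have "N + Suc k < base" "base \<le> out"
      using k(2) base unfolding base_def out_def by auto
    then have centre: "M' (N + Suc k) = M0 (N + Suc k)"
      using I st by (simp add: I_def static_def)
    have I': "R' rQ = 2 ^ T" "R' rCentre = N" "R' rOut = out" "R' rTime = Suc k"
        "\<forall>a<out. M' a = M a" "R' rAddr = out + length (ws (Suc k))"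
        "map M' [out..<out + length (ws (Suc k))] = ws (Suc k)"
      using I unfolding I_def k by blast+
    show ?thesis
    proof (cases "Suc k \<in> X")
      case True
      let ?l = "length (ws (Suc k))"
      let ?M = "M'(out + ?l := M0 (N + Suc k) - 1, Suc (out + ?l) := Suc k)"
      have "map ?M [out..<out + ?l] = map M' [out..<out + ?l]"
        by simp
      then have "map ?M [out..<out + length (ws k)] = ws k"
        using I'(7) True unfolding ws_Suc[OF k(2)] by simp
      then have "I (Suc j) (R'(rX := R' rX + R' rX - 2 ^ T, rAddr := R' rAddr + 2, rTime := k)) ?M"
        using dbl True I' k ws_Suc[OF k(2)] unfolding I_def by simp
      moreover have "2 ^ T \<le> R' rX + R' rX"
        using dbl True by simp
      ultimately show ?thesis
        using centre I' by (intro conjI runs_wp) simp_all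
    next
      case False
      then have "I (Suc j) (R'(rX := R' rX + R' rX, rTime := k)) M'"
        using dbl I' k ws_Suc[OF k(2)] unfolding I_def by simp
      moreover have "\<not> 2 ^ T \<le> R' rX + R' rX"
        using dbl low False by simp
      ultimately show ?thesis
        using I' by (intro conjI runs_wp) simp_all
    qed
  qed
  show ?thesis
    unfolding decode_prog_def
  proof (rule runs_Seq[where ?Q1.0 = "I 0" and ?K1.0 = 10])
    have "X \<inter> {1..T} = X"
      using X by auto
    then show "runs (rOut ::= Add (Reg rOld) (Reg rP) ;; rAddr ::= Reg rOut ;; rTime ::= Reg rT)
        R M 10 (I 0)"
      using regs X by (intro runs_wp) (auto simp: I_def out_def ws_def)
    fix R1 M1 assume I0: "I 0 R1 M1"
    show "runs (While (Reg rTime)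
       (rX ::= Add (Reg rX) (Reg rX) ;;
        Cond (le_exp (Reg rQ) (Reg rX))
          (rX ::= Sub (Reg rX) (Reg rQ) ;;
           Store (Reg rAddr) (Sub (Mem (Add (Reg rCentre) (Reg rTime))) (Const 1)) ;;
           Store (Add (Reg rAddr) (Const 1)) (Reg rTime) ;;
           rAddr ::= Add (Reg rAddr) (Const 2))
          Skip ;;
        decr rTime) ;;
      rOutLen ::= Sub (Reg rAddr) (Reg rOut)) R1 M1 ((T * 48 + 2) + 4)
      (\<lambda>R' M'. output_word (R', M') =
    concat (map (\<lambda>(v, t). [v, t])
      (map (\<lambda>t. (M0 (N + t) - 1, t)) (filter (\<lambda>t. t \<in> X) (rev [1..<Suc T])))))"
    proof (rule runs_Seq[OF runs_While[where I = I and Q = "I T" and n = T and K = 46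
            and K' = "T * 48 + 2", OF I0 step]])
      show "val (Reg rTime) (R', M') = 0 \<and> I T R' M'" if "I T R' M'" for R' M'
        using that by (simp add: I_def)
      fix R2 M2 assume "I T R2 M2"
      then show "runs (rOutLen ::= Sub (Reg rAddr) (Reg rOut)) R2 M2 4
        (\<lambda>R' M'. output_word (R', M') =
    concat (map (\<lambda>(v, t). [v, t])
      (map (\<lambda>t. (M0 (N + t) - 1, t)) (filter (\<lambda>t. t \<in> X) (rev [1..<Suc T])))))"
        by (intro runs_wp) (simp_all add: I_def output_word_def ws_def del: upt_Suc)
    qed simp_all
  qed simp
qed

end

section \<open>Reading the input\<close>

lemma map_encoding_split:
  assumes "i < length es"
  shows "concat (map f es) = concat (map f (take i es)) @ f (es ! i) @ concat (map f (drop (Suc i) es))"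
proof -
  have "map f es = map f (take i es) @ f (es ! i) # map f (drop (Suc i) es)"
    using id_take_nth_drop[OF assms] by (metis list.simps(9) map_append)
  then show ?thesis
    by simp
qed

locale scan_input =
  fixes n \<Delta> :: nat and es :: "(nat \<times> nat \<times> nat list) list" and xs :: "nat list"
  assumes xs: "xs = [n, length es, \<Delta>] @ concat (map (\<lambda>(u, v, ts). [u, v, length ts] @ ts) es)"
begin

definition fst_end :: "nat \<Rightarrow> nat" where
  "fst_end i = fst (es ! i)"

definition snd_end :: "nat \<Rightarrow> nat" where
  "snd_end i = fst (snd (es ! i))"

definition labels :: "nat \<Rightarrow> nat list" where
  "labels i = snd (snd (es ! i))"

definition pos :: "nat \<Rightarrow> nat" where
  "pos i = 3 + length (concat (map (\<lambda>(u, v, ts). [u, v, length ts] @ ts) (take i es)))"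

lemma pos_0: "pos 0 = 3"
  by (simp add: pos_def)

lemma pos_Suc: "i < length es \<Longrightarrow> pos (Suc i) = pos i + 3 + length (labels i)"
  by (simp add: pos_def take_Suc_conv_app_nth labels_def case_prod_beta)

lemma pos_end: "pos (length es) = length xs"
  by (simp add: pos_def xs)

lemma xs_header: "length xs \<ge> 3" "xs ! Suc 0 = length es" "xs ! 2 = \<Delta>"
  by (simp_all add: xs)

lemma xs_record:
  assumes "i < length es"
  shows "xs ! pos i = fst_end i" "xs ! (pos i + 1) = snd_end i"
    "xs ! (pos i + 2) = length (labels i)"
    "j < length (labels i) \<Longrightarrow> xs ! (pos i + 3 + j) = labels i ! j"
    "pos i + 3 + length (labels i) \<le> length xs"
proof -
  let ?f = "\<lambda>(u, v, ts). [u, v, length ts] @ ts"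
  let ?pre = "[n, length es, \<Delta>] @ concat (map ?f (take i es))"
  let ?post = "concat (map ?f (drop (Suc i) es))"
  have split: "xs = ?pre @ ([fst_end i, snd_end i, length (labels i)] @ labels i) @ ?post"
    unfolding xs map_encoding_split[OF assms]
    by (simp add: fst_end_def snd_end_def labels_def case_prod_beta)
  have len: "length ?pre = pos i"
    by (simp add: pos_def)
  have nth: "xs ! (pos i + k) = (([fst_end i, snd_end i, length (labels i)] @ labels i) @ ?post) ! k" for k
    unfolding split len[symmetric] by (rule nth_append_length_plus)
  show "xs ! pos i = fst_end i" "xs ! (pos i + 1) = snd_end i"
      "xs ! (pos i + 2) = length (labels i)"
    using nth[of 0] nth[of 1] nth[of 2] by simp_all
  show "xs ! (pos i + 3 + j) = labels i ! j" if "j < length (labels i)"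
    using nth[of "3 + j"] that by (simp add: nth_append numeral_3_eq_3)
  have "length xs = pos i + (3 + length (labels i)) + length ?post"
    using arg_cong[OF split, of length] by (simp add: pos_def)
  then show "pos i + 3 + length (labels i) \<le> length xs"
    by simp
qed

text \<open>\<open>J i j\<close> describes the client after \<open>i\<close> complete edges and
  \<open>j\<close> labels of the next. The division of registers is symmetric: \<open>J\<close> must
  ignore 3 to 8, while \<open>body\<close> and \<open>post\<close> must preserve them.\<close>

lemma runs_scan_prog:
  fixes J :: "nat \<Rightarrow> nat \<Rightarrow> (nat \<Rightarrow> nat) \<Rightarrow> (nat \<Rightarrow> nat) \<Rightarrow> bool"
  assumes cong: "\<And>i j R R' M. J i j R M \<Longrightarrow> (\<And>r. r \<notin> {3..8} \<Longrightarrow> R' r = R r) \<Longrightarrow> J i j R' M"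
    and mem: "\<And>i j R M a. J i j R M \<Longrightarrow> a < length xs \<Longrightarrow> M a = xs ! a"
    and body: "\<And>i j R M. i < length es \<Longrightarrow> j < length (labels i) \<Longrightarrow> J i j R M \<Longrightarrow>
      R rU = fst_end i \<Longrightarrow> R rV = snd_end i \<Longrightarrow> R rLabel = labels i ! j \<Longrightarrow>
      runs body R M K (\<lambda>R' M'. J i (Suc j) R' M' \<and> (\<forall>r\<in>{3..8}. R' r = R r))"
    and post: "\<And>i R M. i < length es \<Longrightarrow> J i (length (labels i)) R M \<Longrightarrow>
      runs post R M K (\<lambda>R' M'. J (Suc i) 0 R' M' \<and> (\<forall>r\<in>{3..8}. R' r = R r))"
    and len: "\<And>i. i < length es \<Longrightarrow> length (labels i) \<le> T"
    and init: "J 0 0 R M"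
  shows "runs (scan_prog body post) R M (length es * (T * (K + 20) + K + 40) + 20)
    (\<lambda>R' M'. J (length es) 0 R' M' \<and> R' rPtr = length xs)"
proof -
  let ?m = "length es"
  define I where "I = (\<lambda>i R' M'. J i 0 R' M' \<and> R' rPtr = pos i \<and> R' rEdges = ?m - i)"
  define L where "L = (\<lambda>i j R' M'. J i j R' M' \<and> R' rPtr = pos i + 3 + j \<and> R' rEdges = ?m - i \<and>
    R' rU = fst_end i \<and> R' rV = snd_end i \<and> R' rLabels = length (labels i) - j)"
  have label_step: "val (Reg rLabels) (R', M') \<noteq> 0 \<and>
      runs (rLabel ::= Mem (Reg rPtr) ;; body ;; (incr rPtr ;; decr rLabels)) R' M' (K + 12)
        (L i (Suc j))"
    if i: "i < ?m" and j: "j < length (labels i)" and Lij: "L i j R' M'" for i j R' M'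
  proof
    show "val (Reg rLabels) (R', M') \<noteq> 0"
      using j Lij by (simp add: L_def)
    have "M' (R' rPtr) = labels i ! j"
      using mem[of i j R' M' "R' rPtr"] xs_record(4,5)[OF i] j Lij by (simp add: L_def)
    then have 1: "runs (rLabel ::= Mem (Reg rPtr)) R' M' 4
        (\<lambda>R'' M''. R'' = R'(rLabel := labels i ! j) \<and> M'' = M')"
      by (intro runs_wp) simp_all
    have J: "J i j (R'(rLabel := labels i ! j)) M'"
      by (rule cong[of i j R']) (use Lij in \<open>auto simp: L_def\<close>)
    show "runs (rLabel ::= Mem (Reg rPtr) ;; body ;; (incr rPtr ;; decr rLabels)) R' M' (K + 12)
        (L i (Suc j))"
    proof (rule runs_Seq[OF 1])
      fix R1 M1 assume 1: "R1 = R'(rLabel := labels i ! j) \<and> M1 = M'"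
      show "runs (body ;; (incr rPtr ;; decr rLabels)) R1 M1 (K + 8) (L i (Suc j))"
      proof (rule runs_Seq[OF body[OF i j]])
        fix R2 M2 assume 2: "J i (Suc j) R2 M2 \<and> (\<forall>r\<in>{3..8}. R2 r = R1 r)"
        have "J i (Suc j) (R2(rPtr := x, rLabels := y)) M2" for x y
          by (rule cong[of i "Suc j" R2]) (use 2 in auto)
        with 1 2 Lij show "runs (incr rPtr ;; decr rLabels) R2 M2 8 (L i (Suc j))"
          by (intro runs_wp) (auto simp: L_def)
      qed (use 1 J Lij in \<open>auto simp: L_def\<close>)
    qed simp
  qed
  have edge_step: "val (Reg rEdges) (R', M') \<noteq> 0 \<and>
      runs ((rU ::= Mem (Reg rPtr) ;; rV ::= Mem (Add (Reg rPtr) (Const 1)) ;;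
         rLabels ::= Mem (Add (Reg rPtr) (Const 2)) ;; rPtr ::= Add (Reg rPtr) (Const 3)) ;;
        While (Reg rLabels)
          (rLabel ::= Mem (Reg rPtr) ;; body ;; (incr rPtr ;; decr rLabels)) ;;
        post ;;
        decr rEdges) R' M' (T * (K + 14) + K + 30) (I (Suc i))"
    if i: "i < ?m" and Ii: "I i R' M'" for i R' M'
  proof
    show "val (Reg rEdges) (R', M') \<noteq> 0"
      using i Ii by (simp add: I_def)
    show "runs ((rU ::= Mem (Reg rPtr) ;; rV ::= Mem (Add (Reg rPtr) (Const 1)) ;;
         rLabels ::= Mem (Add (Reg rPtr) (Const 2)) ;; rPtr ::= Add (Reg rPtr) (Const 3)) ;;
        While (Reg rLabels)
          (rLabel ::= Mem (Reg rPtr) ;; body ;; (incr rPtr ;; decr rLabels)) ;;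
        post ;;
        decr rEdges) R' M' (T * (K + 14) + K + 30) (I (Suc i))"
    proof (rule runs_Seq[where ?Q1.0 = "L i 0" and ?K1.0 = 20])
      have "J i 0 (R'(rU := a, rV := b, rLabels := c, rPtr := d)) M'" for a b c d
        by (rule cong[of i 0 R']) (use Ii in \<open>auto simp: I_def\<close>)
      moreover have "\<forall>a<length xs. M' a = xs ! a" "R' rPtr = pos i" "R' rEdges = ?m - i"
        using Ii mem unfolding I_def by blast+
      ultimately show "runs (rU ::= Mem (Reg rPtr) ;; rV ::= Mem (Add (Reg rPtr) (Const 1)) ;;
         rLabels ::= Mem (Add (Reg rPtr) (Const 2)) ;; rPtr ::= Add (Reg rPtr) (Const 3))
         R' M' 20 (L i 0)"
        using xs_record[OF i] by (intro runs_wp) (simp_all add: L_def)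
      fix R1 M1 assume L0: "L i 0 R1 M1"
      show "runs (While (Reg rLabels)
          (rLabel ::= Mem (Reg rPtr) ;; body ;; (incr rPtr ;; decr rLabels)) ;;
        post ;; decr rEdges) R1 M1 ((T * (K + 14) + 2) + (K + 4)) (I (Suc i))"
      proof (rule runs_Seq[where ?Q1.0 = "L i (length (labels i))"])
        have "length (labels i) * (14 + K) \<le> T * (K + 14)"
          using mult_le_mono1[OF len[OF i], of "K + 14"] by (simp only: add.commute)
        then show "runs (While (Reg rLabels)
          (rLabel ::= Mem (Reg rPtr) ;; body ;; (incr rPtr ;; decr rLabels))) R1 M1
          (T * (K + 14) + 2) (L i (length (labels i)))"
          by (intro runs_While[where I = "L i" and n = "length (labels i)" and K = "K + 12",
                OF L0 label_step[OF i]]) (simp_all add: L_def)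
        fix R2 M2 assume 2: "L i (length (labels i)) R2 M2"
        show "runs (post ;; decr rEdges) R2 M2 (K + 4) (I (Suc i))"
        proof (rule runs_Seq[OF post[OF i]])
          fix R3 M3 assume 3: "J (Suc i) 0 R3 M3 \<and> (\<forall>r\<in>{3..8}. R3 r = R2 r)"
          have "J (Suc i) 0 (R3(rEdges := x)) M3" for x
            by (rule cong[of "Suc i" 0 R3]) (use 3 in auto)
          with 2 3 show "runs (decr rEdges) R3 M3 4 (I (Suc i))"
            by (intro runs_wp) (auto simp: L_def I_def pos_Suc[OF i])
        qed (use 2 in \<open>simp_all add: L_def\<close>)
      qed simp
    qed simp
  qed
  show ?thesis
    unfolding scan_prog_def
  proof (rule runs_Seq[where ?Q1.0 = "I 0" and ?K1.0 = 10])
    have "J 0 0 (R(rPtr := x, rEdges := y)) M" for x y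
      using init by (rule cong) auto
    moreover have "M (Suc 0) = ?m"
      using mem[OF init] xs_header by simp
    ultimately show "runs (rPtr ::= Const 3 ;; rEdges ::= Mem (Const 1)) R M 10 (I 0)"
      by (intro runs_wp) (simp_all add: I_def pos_0)
    show "runs (While (Reg rEdges)
       ((rU ::= Mem (Reg rPtr) ;; rV ::= Mem (Add (Reg rPtr) (Const 1)) ;;
         rLabels ::= Mem (Add (Reg rPtr) (Const 2)) ;; rPtr ::= Add (Reg rPtr) (Const 3)) ;;
        While (Reg rLabels)
          (rLabel ::= Mem (Reg rPtr) ;; body ;; (incr rPtr ;; decr rLabels)) ;;
        post ;;
        decr rEdges)) R1 M1 (?m * (T * (K + 14) + K + 32) + 2)
        (\<lambda>R' M'. J ?m 0 R' M' \<and> R' rPtr = length xs)" if "I 0 R1 M1" for R1 M1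
      by (rule runs_While[where I = I and n = ?m, OF that edge_step])
        (simp_all add: I_def pos_end)
    have "?m * (T * (K + 14) + K + 32) \<le> ?m * (T * (K + 20) + K + 40)"
      by (intro mult_le_mono2 add_le_mono) simp_all
    then show "10 + (?m * (T * (K + 14) + K + 32) + 2) \<le> ?m * (T * (K + 20) + K + 40) + 20"
      by linarith
  qed
qed

text \<open>The label occurrences processed before label \<open>j\<close> of edge \<open>i\<close>.\<close>

definition seen :: "nat \<Rightarrow> nat \<Rightarrow> nat \<Rightarrow> nat \<Rightarrow> bool" where
  "seen i j k t \<longleftrightarrow> k < i \<and> t \<in> set (labels k) \<or> k = i \<and> t \<in> set (take j (labels i))"

lemma seen_0: "\<not> seen 0 0 k t"
  by (simp add: seen_def)

lemma seen_Suc: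
  "j < length (labels i) \<Longrightarrow> seen i (Suc j) k t \<longleftrightarrow> seen i j k t \<or> k = i \<and> t = labels i ! j"
  by (auto simp: seen_def take_Suc_conv_app_nth)

lemma seen_next: "seen (Suc i) 0 k t \<longleftrightarrow> seen i (length (labels i)) k t"
  by (auto simp: seen_def less_Suc_eq)

lemma seen_end: "seen i 0 k t \<longleftrightarrow> k < i \<and> t \<in> set (labels k)"
  by (simp add: seen_def)

lemma runs_lifetime_scan:
  assumes len: "\<And>i. i < length es \<Longrightarrow> length (labels i) \<le> T"
    and T: "T = Max (\<Union>i<length es. set (labels i))" and ne: "(\<Union>i<length es. set (labels i)) \<noteq> {}"
    and M: "\<And>a. a < length xs \<Longrightarrow> M a = xs ! a" and R: "R rT = 0"
  shows "runs (scan_prog lifetime_body Skip) R M (length es * (T * 30 + 50) + 20)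
    (\<lambda>R' M'. M' = M \<and> R' rT = T \<and> R' rPtr = length xs)"
proof -
  define J where "J = (\<lambda>i j R' M'. M' = M \<and> (\<forall>k t. seen i j k t \<longrightarrow> t \<le> R' rT) \<and>
    (R' rT = 0 \<or> (\<exists>k. seen i j k (R' rT))))"
  have "runs (scan_prog lifetime_body Skip) R M (length es * (T * (10 + 20) + 10 + 40) + 20)
    (\<lambda>R' M'. J (length es) 0 R' M' \<and> R' rPtr = length xs)"
  proof (rule runs_scan_prog[OF _ _ _ _ len])
    fix i j R' M'
    assume j: "j < length (labels i)" and J: "J i j R' M'" and t: "R' rLabel = labels i ! j"
    have "J i (Suc j) (R'(rT := labels i ! j)) M'" if "R' rT < labels i ! j"
      using that J unfolding J_def seen_Suc[OF j] by (auto intro: less_imp_le dest: le_less_trans)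
    moreover have "J i (Suc j) R' M'" if "\<not> R' rT < labels i ! j"
      using that J unfolding J_def seen_Suc[OF j] by auto
    ultimately show "runs lifetime_body R' M' 10
        (\<lambda>R'' M''. J i (Suc j) R'' M'' \<and> (\<forall>r\<in>{3..8}. R'' r = R' r))"
      unfolding lifetime_body_def using t by (intro runs_wp) auto
  next
    fix i R' M'
    assume "J i (length (labels i)) R' M'"
    then show "runs Skip R' M' 10 (\<lambda>R'' M''. J (Suc i) 0 R'' M'' \<and> (\<forall>r\<in>{3..8}. R'' r = R' r))"
      by (intro runs_wp) (simp_all add: J_def seen_next)
  qed (auto simp: J_def M R seen_0)
  then show ?thesis
  proof (rule runs_conseq)
    fix R' M' assume J: "J (length es) 0 R' M' \<and> R' rPtr = length xs"
    let ?S = "\<Union>i<length es. set (labels i)"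
    have le: "\<forall>t\<in>?S. t \<le> R' rT" and at: "R' rT = 0 \<or> R' rT \<in> ?S"
      using J by (auto simp: J_def seen_end)
    \<comment> \<open>If the register is still 0, every label is at most 0, and nonemptiness puts 0
      itself into the set.\<close>
    then have "R' rT \<in> ?S"
      using ne by fastforce
    then have "R' rT = T"
      unfolding T using le by (intro Max_eqI[symmetric]) auto
    with J show "M' = M \<and> R' rT = T \<and> R' rPtr = length xs"
      by (simp add: J_def)
  qed simp
qed

text \<open>Memory behind the input is used as a table with rows of length \<open>T + 1\<close>: rows \<open>0\<close> and \<open>1\<close> hold
  two candidates for the centre at each time, both shifted by one so that \<open>0\<close> means undefined, and
  row \<open>k + 2\<close> holds the activity of edge \<open>k\<close>.\<close>

definition table_mem :: "nat \<Rightarrow> (nat \<Rightarrow> nat \<Rightarrow> nat) \<Rightarrow> nat \<Rightarrow> nat" where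
  "table_mem T G a = (if a < length xs then xs ! a
     else G ((a - length xs) div Suc T) ((a - length xs) mod Suc T))"

lemma table_mem_cell: "t \<le> T \<Longrightarrow> table_mem T G (length xs + r * Suc T + t) = G r t"
  by (simp add: table_mem_def div_add1_eq del: mult_Suc_right)

text \<open>Quotient and remainder by \<open>Suc T\<close> determine row and column uniquely, so a
  store changes one entry of \<open>G\<close> and the client proof can avoid address
  arithmetic.\<close>

lemma table_mem_upd:
  assumes "t \<le> T"
  shows "(table_mem T G)(length xs + r * Suc T + t := x) = table_mem T (G(r := (G r)(t := x)))"
proof
  fix a
  show "((table_mem T G)(length xs + r * Suc T + t := x)) a = table_mem T (G(r := (G r)(t := x))) a"
  proof (cases "a = length xs + r * Suc T + t")
    case True
    then show ?thesis
      using table_mem_cell[OF assms] by simp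
  next
    case False
    then have "\<not> ((a - length xs) div Suc T = r \<and> (a - length xs) mod Suc T = t)" if "\<not> a < length xs"
      using that by (metis add.assoc div_mult_mod_eq le_add_diff_inverse not_less)
    then show ?thesis
      using False by (auto simp: table_mem_def)
  qed
qed

abbreviation ends :: "nat \<Rightarrow> nat set" where
  "ends k \<equiv> {fst_end k, snd_end k}"

text \<open>\<open>S\<close> is the set of edges seen so far at some time whose star has centre \<open>c\<close>. Until an edge
  avoiding the first candidate \<open>x\<close> shows up, \<open>x\<close> may be a leaf of the only edge seen.\<close>

definition centre_inv :: "nat \<Rightarrow> nat set \<Rightarrow> nat \<Rightarrow> nat \<Rightarrow> bool" where
  "centre_inv c S x y \<longleftrightarrow> (x = 0 \<longleftrightarrow> S = {}) \<and>
     (S \<noteq> {} \<longrightarrow> x = Suc c \<or> y = Suc c \<and> (\<exists>x'. x = Suc x' \<and> (\<forall>k\<in>S. ends k = {x', c})))"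

text \<open>The row index \<open>k\<close> is deliberately unbounded: rows of edges that do not
  exist are thereby known to be zero, which later provides the zero memory behind the table.\<close>

definition table_inv :: "(nat \<Rightarrow> nat) \<Rightarrow> nat \<Rightarrow> nat \<Rightarrow> nat \<Rightarrow> (nat \<Rightarrow> nat \<Rightarrow> nat) \<Rightarrow> bool" where
  "table_inv c T i j G \<longleftrightarrow> (\<forall>t\<le>T. (\<forall>k. G (Suc (Suc k)) t = of_bool (seen i j k t)) \<and>
     centre_inv (c t) {k. seen i j k t} (G 0 t) (G 1 t))"

lemma centre_inv_first:
  "c \<in> ends i \<Longrightarrow> centre_inv c {i} (Suc (fst_end i)) (Suc (snd_end i))"
  by (auto simp: centre_inv_def)

text \<open>If the first candidate \<open>x'\<close> is not the centre \<open>c\<close>, an edge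
  containing both is \<open>{x', c}\<close>, so it repeats the ambiguity and leaves both candidates
  valid.\<close>

lemma centre_inv_keep:
  "centre_inv c S x y \<Longrightarrow> c \<in> ends i \<Longrightarrow> x = Suc (fst_end i) \<or> x = Suc (snd_end i) \<Longrightarrow>
    centre_inv c (insert i S) x y"
  by (auto simp: centre_inv_def doubleton_eq_iff)

text \<open>The centre lies on the new edge and the first candidate does not, so the second
  candidate is the centre. It appears twice because row 1 keeps its value when it is copied to row
  0.\<close>

lemma centre_inv_swap:
  "centre_inv c S x y \<Longrightarrow> c \<in> ends i \<Longrightarrow> x \<noteq> 0 \<Longrightarrow> x \<noteq> Suc (fst_end i) \<Longrightarrow> x \<noteq> Suc (snd_end i) \<Longrightarrow>
    centre_inv c (insert i S) y y"
  by (auto simp: centre_inv_def)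

lemma table_inv_step:
  assumes inv: "table_inv c T i j G" and j: "j < length (labels i)" and t: "labels i ! j = t"
    and G': "G' = G(Suc (Suc i) := (G (Suc (Suc i)))(t := 1), 0 := (G 0)(t := x), 1 := (G 1)(t := y))"
    and centre: "t \<le> T \<Longrightarrow> centre_inv (c t) (insert i {k. seen i j k t}) x y"
  shows "table_inv c T i (Suc j) G'"
  unfolding table_inv_def
proof (intro allI impI conjI)
  fix s k assume s: "s \<le> T"
  show "G' (Suc (Suc k)) s = of_bool (seen i (Suc j) k s)"
    using inv s unfolding table_inv_def seen_Suc[OF j] by (auto simp: G' t)
  have "{k. seen i (Suc j) k s} = (if s = t then insert i {k. seen i j k s} else {k. seen i j k s})"
    unfolding seen_Suc[OF j] t by auto
  then show "centre_inv (c s) {k. seen i (Suc j) k s} (G' 0 s) (G' 1 s)"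
    using inv s centre by (auto simp: G' table_inv_def)
qed

lemma runs_table_scan:
  assumes len: "\<And>i. i < length es \<Longrightarrow> length (labels i) \<le> T"
    and le: "\<And>i t. i < length es \<Longrightarrow> t \<in> set (labels i) \<Longrightarrow> t \<le> T"
    and c: "\<And>i t. i < length es \<Longrightarrow> t \<in> set (labels i) \<Longrightarrow> c t \<in> ends i"
    and M: "\<And>a. M a = (if a < length xs then xs ! a else 0)"
    and R: "R rT = T" "R rPtr = length xs"
  shows "runs (table_init ;; scan_prog table_body table_post) R M
    (length es * (T * 120 + 140) + 50)
    (\<lambda>R' M'. R' rT = T \<and> R' rStride = Suc T \<and> R' rCentre = length xs \<and>
      R' rSpare = length xs + Suc T \<and> R' rRow = length xs + (2 + length es) * Suc T \<and>
      (\<exists>G. M' = table_mem T G \<and> table_inv c T (length es) 0 G))"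
proof -
  define J where "J = (\<lambda>i j R' M'. R' rT = T \<and> R' rStride = Suc T \<and> R' rCentre = length xs \<and>
      R' rSpare = length xs + Suc T \<and> R' rRow = length xs + (2 + i) * Suc T \<and>
      (\<exists>G. M' = table_mem T G \<and> table_inv c T i j G))"
  have init: "runs table_init R M 30 (J 0 0)"
  proof -
    have "M = table_mem T (\<lambda>_ _. 0)"
      using M by (auto simp: table_mem_def)
    moreover have "table_inv c T 0 0 (\<lambda>_ _. 0)"
      by (simp add: table_inv_def seen_0 centre_inv_def)
    ultimately show ?thesis
      unfolding table_init_def using R by (intro runs_wp) (auto simp: J_def)
  qed
  have body: "runs table_body R' M' 100
      (\<lambda>R'' M''. J i (Suc j) R'' M'' \<and> (\<forall>r\<in>{3..8}. R'' r = R' r))"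
    if i: "i < length es" and j: "j < length (labels i)" and J: "J i j R' M'"
      and reg: "R' rU = fst_end i" "R' rV = snd_end i" "R' rLabel = labels i ! j" for i j R' M'
  proof -
    obtain G where G: "M' = table_mem T G" "table_inv c T i j G"
      using J by (auto simp: J_def)
    define t where "t = labels i ! j"
    have "t \<in> set (labels i)"
      using j by (simp add: t_def)
    then have tT: "t \<le> T" and ct: "c t \<in> ends i"
      using le c i by auto
    have "R' rCentre + R' rLabel = length xs + 0 * Suc T + t"
        "R' rSpare + R' rLabel = length xs + 1 * Suc T + t"
        "R' rRow + R' rLabel = length xs + Suc (Suc i) * Suc T + t"
      using J reg by (simp_all add: J_def t_def)
    then have table:
        "\<And>H. table_mem T H (R' rCentre + R' rLabel) = H 0 t"
        "\<And>H. table_mem T H (R' rSpare + R' rLabel) = H 1 t"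
        "\<And>H z. (table_mem T H)(R' rCentre + R' rLabel := z) = table_mem T (H(0 := (H 0)(t := z)))"
        "\<And>H z. (table_mem T H)(R' rSpare + R' rLabel := z) = table_mem T (H(1 := (H 1)(t := z)))"
        "\<And>H z. (table_mem T H)(R' rRow + R' rLabel := z) =
          table_mem T (H(Suc (Suc i) := (H (Suc (Suc i)))(t := z)))"
      by (simp_all only: table_mem_cell[OF tT] table_mem_upd[OF tT])
    have inv: "centre_inv (c t) {k. seen i j k t} (G 0 t) (G 1 t)"
      using G(2) tT by (simp add: table_inv_def)
    let ?G1 = "G(Suc (Suc i) := (G (Suc (Suc i)))(t := 1))"
    have post: "J i (Suc j) R' (table_mem T G') \<and> (\<forall>r\<in>{3..8}. R' r = R' r)"
      if "table_inv c T i (Suc j) G'" for G'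
      using J that unfolding J_def by blast
    have *: "table_inv c T i (Suc j) (?G1(0 := (?G1 0)(t := x), 1 := (?G1 1)(t := y)))"
      if "centre_inv (c t) (insert i {k. seen i j k t}) x y" for x y
      by (rule table_inv_step[OF G(2) j t_def[symmetric] _ that]) simp
    \<comment> \<open>The cases follow the branches of \<open>table_body\<close>: no candidate yet,
      first candidate on the edge, first candidate refuted.\<close>
    consider "G 0 t = 0" | "G 0 t \<noteq> 0" "G 0 t = Suc (fst_end i) \<or> G 0 t = Suc (snd_end i)"
      | "G 0 t \<noteq> 0" "G 0 t \<noteq> Suc (fst_end i)" "G 0 t \<noteq> Suc (snd_end i)"
      by blast
    then show ?thesis
    proof cases
      case 1
      then have "{k. seen i j k t} = {}"
        using inv by (simp add: centre_inv_def)
      then have "centre_inv (c t) (insert i {k. seen i j k t}) (Suc (fst_end i)) (Suc (snd_end i))"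
        using centre_inv_first[OF ct] by simp
      from post[OF *[OF this]] show ?thesis
        unfolding table_body_def using 1 reg(1,2)
        by (intro runs_wp) (simp_all add: G(1) table)
    next
      case 2
      \<comment> \<open>Rewriting the candidates with their own values changes nothing, so the
        general update also describes the branch without stores to them.\<close>
      have "?G1(0 := (?G1 0)(t := G 0 t), 1 := (?G1 1)(t := G 1 t)) = ?G1"
        by auto
      with post[OF *[OF centre_inv_keep[OF inv ct 2(2)]]] show ?thesis
        unfolding table_body_def using 2 reg(1,2)
        by (intro runs_wp) (auto simp: G(1) table)
    next
      case 3
      have "?G1(0 := (?G1 0)(t := G 1 t), 1 := (?G1 1)(t := G 1 t)) = ?G1(0 := (?G1 0)(t := G 1 t))"
        by auto
      with post[OF *[OF centre_inv_swap[OF inv ct 3]]] show ?thesis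
        unfolding table_body_def using 3 reg(1,2)
        by (intro runs_wp) (auto simp: G(1) table)
    qed
  qed
  show ?thesis
  proof (rule runs_Seq[OF init])
    fix R1 M1 assume J: "J 0 0 R1 M1"
    have "runs (scan_prog table_body table_post) R1 M1 (length es * (T * (100 + 20) + 100 + 40) + 20)
      (\<lambda>R' M'. J (length es) 0 R' M' \<and> R' rPtr = length xs)"
    proof (rule runs_scan_prog[where J = J, OF _ _ body _ len J])
      fix i j R' R'' M'
      assume "J i j R' M'" "\<And>r. r \<notin> {3..8} \<Longrightarrow> R'' r = R' r"
      then show "J i j R'' M'"
        by (simp add: J_def)
    next
      fix i j R' M' a
      assume "J i j R' M'" "a < length xs"
      then show "M' a = xs ! a"
        by (auto simp: J_def table_mem_def)
    next
      fix i R' M'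
      assume "i < length es" "J i (length (labels i)) R' M'"
      then show "runs table_post R' M' 100
          (\<lambda>R'' M''. J (Suc i) 0 R'' M'' \<and> (\<forall>r\<in>{3..8}. R'' r = R' r))"
        unfolding table_post_def
        by (intro runs_wp) (auto simp: J_def table_inv_def seen_next)
    qed
    then show "runs (scan_prog table_body table_post) R1 M1 (length es * (T * 120 + 140) + 20)
      (\<lambda>R' M'. R' rT = T \<and> R' rStride = Suc T \<and> R' rCentre = length xs \<and>
      R' rSpare = length xs + Suc T \<and> R' rRow = length xs + (2 + length es) * Suc T \<and>
      (\<exists>G. M' = table_mem T G \<and> table_inv c T (length es) 0 G))"
      by (rule runs_conseq) (simp_all add: J_def)
  qed simp
qed

end

section \<open>The complete program\<close>

lemma runs_powers_prog:
  assumes "M 2 = \<Delta>" "R rT = T"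
  shows "runs powers_prog R M (10 * \<Delta> + 20 * T + 30)
    (\<lambda>R' M'. (\<forall>r<13. R' r = R r) \<and> M' = M \<and>
      R' rP = 2 ^ \<Delta> \<and> R' rQ = 2 ^ T \<and> R' rInf = 2 ^ T * 2 ^ T)"
proof -
  let ?Q1 = "\<lambda>R' M'. R' = R(rP := 1, rI := \<Delta>) \<and> M' = M"
  let ?Q2 = "\<lambda>R' M'. R' = R(rP := 2 ^ \<Delta>, rQ := 1, rI := T) \<and> M' = M"
  let ?Q3 = "\<lambda>R' M'. R' = R(rP := 2 ^ \<Delta>, rQ := 2 ^ T, rInf := 2 ^ T, rI := T) \<and> M' = M"
  show ?thesis
    unfolding powers_prog_def
  proof (rule runs_Seq[where ?Q1.0 = ?Q1 and ?K1.0 = 6])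
    show "runs (rP ::= Const 1 ;; rI ::= Mem (Const 2)) R M 6 ?Q1"
      using assms by (intro runs_wp) auto
    fix R1 M1 assume 1: "?Q1 R1 M1"
    show "runs (double_prog rP ;; (rQ ::= Const 1 ;; rI ::= Reg rT) ;; double_prog rQ ;;
      (rInf ::= Reg rQ ;; rI ::= Reg rT) ;; double_prog rInf) R1 M1 (10 * \<Delta> + 20 * T + 20)
      (\<lambda>R' M'. (\<forall>r<13. R' r = R r) \<and> M' = M \<and>
        R' rP = 2 ^ \<Delta> \<and> R' rQ = 2 ^ T \<and> R' rInf = 2 ^ T * 2 ^ T)"
    proof (rule runs_Seq[OF runs_double_prog])
      fix R2 M2 assume 2: "R2 = R1(rP := 2 ^ R1 rI * R1 rP, rI := 0) \<and> M2 = M1"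
      show "runs ((rQ ::= Const 1 ;; rI ::= Reg rT) ;; double_prog rQ ;;
        (rInf ::= Reg rQ ;; rI ::= Reg rT) ;; double_prog rInf) R2 M2 (20 * T + 16)
        (\<lambda>R' M'. (\<forall>r<13. R' r = R r) \<and> M' = M \<and>
          R' rP = 2 ^ \<Delta> \<and> R' rQ = 2 ^ T \<and> R' rInf = 2 ^ T * 2 ^ T)"
      proof (rule runs_Seq[where ?Q1.0 = ?Q2 and ?K1.0 = 4])
        show "runs (rQ ::= Const 1 ;; rI ::= Reg rT) R2 M2 4 ?Q2"
          using 1 2 assms by (intro runs_wp) (auto simp: fun_eq_iff)
        fix R3 M3 assume 3: "?Q2 R3 M3"
        show "runs (double_prog rQ ;; (rInf ::= Reg rQ ;; rI ::= Reg rT) ;; double_prog rInf)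
          R3 M3 (20 * T + 12)
          (\<lambda>R' M'. (\<forall>r<13. R' r = R r) \<and> M' = M \<and>
            R' rP = 2 ^ \<Delta> \<and> R' rQ = 2 ^ T \<and> R' rInf = 2 ^ T * 2 ^ T)"
        proof (rule runs_Seq[OF runs_double_prog])
          fix R4 M4 assume 4: "R4 = R3(rQ := 2 ^ R3 rI * R3 rQ, rI := 0) \<and> M4 = M3"
          show "runs ((rInf ::= Reg rQ ;; rI ::= Reg rT) ;; double_prog rInf) R4 M4 (10 * T + 6)
            (\<lambda>R' M'. (\<forall>r<13. R' r = R r) \<and> M' = M \<and>
              R' rP = 2 ^ \<Delta> \<and> R' rQ = 2 ^ T \<and> R' rInf = 2 ^ T * 2 ^ T)"
          proof (rule runs_Seq[where ?Q1.0 = ?Q3 and ?K1.0 = 4])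
            show "runs (rInf ::= Reg rQ ;; rI ::= Reg rT) R4 M4 4 ?Q3"
              using 3 4 assms by (intro runs_wp) (auto simp: fun_eq_iff)
            fix R5 M5 assume 5: "?Q3 R5 M5"
            then show "runs (double_prog rInf) R5 M5 (10 * T + 2)
              (\<lambda>R' M'. (\<forall>r<13. R' r = R r) \<and> M' = M \<and>
                R' rP = 2 ^ \<Delta> \<and> R' rQ = 2 ^ T \<and> R' rInf = 2 ^ T * 2 ^ T)"
              by (intro runs_conseq[OF runs_double_prog]) auto
          qed simp
        qed (use 3 in simp_all)
      qed simp
    qed (use 1 in simp_all)
  qed simp
qed

locale star_instance = scan_input n \<Delta> es xs
  for n \<Delta> :: nat and es :: "(nat \<times> nat \<times> nat list) list" and xs :: "nat list" +
  fixes E :: "nat set set" and lam :: "nat set \<Rightarrow> nat set"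
  assumes star: "always_star {..<n} E lam"
    and \<Delta>: "1 \<le> \<Delta>" "\<Delta> \<le> lifetime E lam"
    and distinct_es: "distinct (map (\<lambda>(u, v, ts). {u, v}) es)"
    and set_es: "set (map (\<lambda>(u, v, ts). {u, v}) es) = E"
    and labels_es: "\<forall>(u, v, ts)\<in>set es. distinct ts \<and> set ts = lam {u, v}"
begin

section \<open>Properties of an encoded always star instance\<close>

abbreviation "T \<equiv> lifetime E lam"
abbreviation "m \<equiv> length es"

lemma E_eq: "E = ends ` {..<m}"
  unfolding set_es[symmetric] set_conv_nth
  by (force simp: fst_end_def snd_end_def case_prod_beta)

lemma labels_eq: "i < m \<Longrightarrow> set (labels i) = lam (ends i)" "i < m \<Longrightarrow> distinct (labels i)"
  using labels_es nth_mem[of i es] unfolding labels_def fst_end_def snd_end_def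
  by (cases "es ! i"; force)+

lemma card_E: "card E = m"
  unfolding set_es[symmetric] using distinct_card[OF distinct_es] by simp

lemma temporal: "temporal_graph {..<n} E lam"
  using star by (simp add: always_star_def)

lemma m_pos: "1 \<le> m"
  using temporal E_eq by (cases "m = 0") (auto simp: temporal_graph_def)

lemma T_eq: "T = Max (\<Union>i<m. set (labels i))"
  unfolding lifetime_def E_eq using labels_eq(1) by simp

lemma label_bounds:
  assumes "i < m" "t \<in> set (labels i)" shows "t \<in> {1..T}"
proof -
  have "t \<le> T"
    unfolding T_eq using assms by (intro Max_ge) auto
  moreover have "0 \<notin> lam (ends i)"
    using temporal E_eq assms(1) by (auto simp: temporal_graph_def)
  then have "t \<noteq> 0"
    using labels_eq(1)[OF assms(1)] assms(2) by (metis)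
  ultimately show ?thesis
    by simp
qed

lemma length_labels: "i < m \<Longrightarrow> length (labels i) \<le> T"
  using distinct_card[OF labels_eq(2)] card_mono[of "{1..T}" "set (labels i)"] label_bounds
  by fastforce

text \<open>A reference choice for the proof only. For a snapshot with one edge it may differ from
  the vertex the program finds.\<close>

definition centre :: "nat \<Rightarrow> nat" where
  "centre t = (SOME c. c < n \<and> (\<forall>e\<in>snapshot E lam t. c \<in> e))"

lemma centre:
  assumes "t \<in> {1..T}" shows "centre t < n \<and> (\<forall>e\<in>snapshot E lam t. centre t \<in> e)"
proof -
  have "star_graph {..<n} (snapshot E lam t)"
    using star assms by (simp add: always_star_def)
  then have "\<exists>c. c < n \<and> (\<forall>e\<in>snapshot E lam t. c \<in> e)"
    unfolding star_graph_def by auto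
  then show ?thesis
    unfolding centre_def by (rule someI_ex)
qed

lemma centre_label: "i < m \<Longrightarrow> t \<in> set (labels i) \<Longrightarrow> centre t \<in> ends i"
  using centre[OF label_bounds] labels_eq(1) E_eq by (auto simp: snapshot_def)

text \<open>The first candidate need not be \<open>centre t\<close>, but in the ambiguous case all
  edges at time \<open>t\<close> are \<open>{x, centre t}\<close>, and \<open>x\<close> covers them
  equally well.\<close>

lemma table_centre:
  assumes G: "table_inv centre T m 0 G" and t: "t \<in> {1..T}"
  shows "G 0 t - 1 < n \<and> (\<forall>e\<in>snapshot E lam t. G 0 t - 1 \<in> e)"
proof -
  let ?S = "{k. seen m 0 k t}"
  have inv: "centre_inv (centre t) ?S (G 0 t) (G 1 t)"
    using G t by (simp add: table_inv_def)
  have snap: "snapshot E lam t = ends ` ?S"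
    using E_eq labels_eq(1) by (auto simp: snapshot_def seen_end)
  have sub: "ends k \<subseteq> {..<n}" if "k < m" for k
    using temporal E_eq that unfolding temporal_graph_def by blast
  show ?thesis
  proof (cases "?S = {}")
    case True
    then have "G 0 t = 0"
      using inv by (simp add: centre_inv_def)
    \<comment> \<open>Here truncated subtraction yields vertex 0. It exists because
      \<open>centre t < n\<close>, and there is no edge to cover.\<close>
    then show ?thesis
      using True centre[OF t] snap by auto
  next
    case False
    then consider "G 0 t = Suc (centre t)"
      | x where "G 0 t = Suc x" "\<forall>k\<in>?S. ends k = {x, centre t}"
      using inv by (auto simp: centre_inv_def)
    then show ?thesis
    proof cases
      case 1
      then show ?thesis
        using centre[OF t] by simp
    next
      case 2
      obtain k where "k \<in> ?S"
        using False by blast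
      then have "ends k = {x, centre t}" "ends k \<subseteq> {..<n}"
        using 2(2) sub[of k] by (blast, auto simp: seen_end)
      then have "x < n"
        by blast
      moreover have "x \<in> e" if "e \<in> snapshot E lam t" for e
        using that 2(2) unfolding snap by blast
      ultimately show ?thesis
        using 2(1) by simp
    qed
  qed
qed

text \<open>With \<open>K = T * 2 ^ \<Delta> * m * \<Delta>\<close> and all factors at least 1, each
  of \<open>T * m\<close>, \<open>2 ^ \<Delta>\<close>, \<open>m\<close>, \<open>T\<close>,
  \<open>\<Delta>\<close> and 1 is at most \<open>K\<close>. The coefficients add up to 900, so 2000
  leaves room.\<close>

lemma cover_prog_time:
  "(m * (T * 30 + 50) + 20) + ((m * (T * 120 + 140) + 50) + ((10 * \<Delta> + 20 * T + 30) +
     (270 * (T * (2 ^ \<Delta> * (m * \<Delta>))) + ((30 * 2 ^ \<Delta> + 20 * T + 30) + (50 * T + 30)))))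
   \<le> 2000 * (T * \<Delta> * (n + m) * 2 ^ \<Delta>)"
proof -
  define P where "P = (2::nat) ^ \<Delta>"
  define K where "K = T * (P * (m * \<Delta>))"
  have pos: "1 \<le> P" "1 \<le> T" "1 \<le> \<Delta>" "1 \<le> m"
    using \<Delta> m_pos by (auto simp: P_def)
  have "1 * 1 \<le> P * \<Delta>" "1 * 1 \<le> T * m" "1 * 1 \<le> T * \<Delta>" "1 * 1 \<le> m * \<Delta>"
    using pos by (intro mult_le_mono; simp)+
  then have ge: "1 \<le> P * \<Delta>" "1 \<le> T * m" "1 \<le> T * \<Delta>" "1 \<le> m * \<Delta>"
    by simp_all
  have "T * m * 1 \<le> T * m * (P * \<Delta>)" "P * 1 * 1 \<le> P * (T * \<Delta>) * m"
    using ge pos by (intro mult_le_mono; simp)+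
  then have K1: "T * m \<le> K" and K2: "P \<le> K"
    by (simp_all add: K_def algebra_simps)
  have "m \<le> T * m" "T \<le> T * m"
    using mult_le_mono1[OF pos(2), of m] mult_le_mono2[OF pos(4), of T] by (simp_all only: mult_1 mult_1_right)
  with K1 have K3: "m \<le> K" and K4: "T \<le> K"
    by linarith+
  have K5: "\<Delta> \<le> K" "1 \<le> K"
    using K4 \<Delta> by simp_all
  have "m * (T * 30 + 50) = 30 * (T * m) + 50 * m" "m * (T * 120 + 140) = 120 * (T * m) + 140 * m"
    by (simp_all add: algebra_simps)
  then have "(m * (T * 30 + 50) + 20) + ((m * (T * 120 + 140) + 50) + ((10 * \<Delta> + 20 * T + 30) +
     (270 * K + ((30 * P + 20 * T + 30) + (50 * T + 30))))) \<le> 2000 * K"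
    using K1 K2 K3 K4 K5 by linarith
  also have "K \<le> T * \<Delta> * (n + m) * P"
    by (simp add: K_def algebra_simps)
  then have "2000 * K \<le> 2000 * (T * \<Delta> * (n + m) * P)"
    by simp
  finally show ?thesis
    by (simp only: P_def K_def)
qed

lemma cover_prog_correct:
  "\<exists>S ys k. computes_in cover_prog xs ys k \<and> encodes_appearances S ys \<and>
     minimum_sliding_window_tvc {..<n} E lam \<Delta> S \<and> k \<le> 2000 * (T * \<Delta> * (n + card E) * 2 ^ \<Delta>)"
proof -
  define act where "act = (\<lambda>i t. t \<in> lam (ends i))"
  let ?N = "length xs"
  let ?M = "\<lambda>a. if a < ?N then xs ! a else 0"
  define Post where "Post = (\<lambda>R M. \<exists>S. encodes_appearances S (output_word (R, M)) \<and>
    minimum_sliding_window_tvc {..<n} E lam \<Delta> S)"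
  have ne: "(\<Union>i<m. set (labels i)) \<noteq> {}"
    using m_pos labels_eq(1) temporal E_eq by (fastforce simp: temporal_graph_def)
  have "runs cover_prog (\<lambda>_. 0) ?M (2000 * (T * \<Delta> * (n + m) * 2 ^ \<Delta>)) Post"
    unfolding cover_prog_def
  proof (rule runs_Seq[OF runs_lifetime_scan[OF length_labels T_eq ne] _ cover_prog_time])
    fix R1 M1 assume 1: "M1 = ?M \<and> R1 rT = T \<and> R1 rPtr = ?N"
    let ?rest2 = "powers_prog ;; dp_prog ;; pick_prog ;; decode_prog"
    let ?Q2 = "\<lambda>R' M'. R' rT = T \<and> R' rStride = Suc T \<and> R' rCentre = ?N \<and>
      R' rSpare = ?N + Suc T \<and> R' rRow = ?N + (2 + m) * Suc T \<and>
      (\<exists>G. M' = table_mem T G \<and> table_inv centre T m 0 G)"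
    have table: "runs (table_init ;; scan_prog table_body table_post) R1 M1 (m * (T * 120 + 140) + 50) ?Q2"
      by (rule runs_table_scan)
        (use 1 length_labels label_bounds centre_label in auto)
    have rest: "runs ?rest2 R2 M2 ((10 * \<Delta> + 20 * T + 30) +
     (270 * (T * (2 ^ \<Delta> * (m * \<Delta>))) + ((30 * 2 ^ \<Delta> + 20 * T + 30) + (50 * T + 30)))) Post"
      if 2: "?Q2 R2 M2" for R2 M2
    proof -
      obtain G where M2: "M2 = table_mem T G" and G: "table_inv centre T m 0 G"
        using 2 by blast
      have M2_act: "M2 (?N + (2 + e) * Suc T + t) = of_bool (act e t)" if "e < m" "t \<le> T" for e t
        using table_mem_cell[OF that(2), of G "2 + e"] G that labels_eq(1)[OF that(1)]
        unfolding M2 table_inv_def act_def by (simp add: seen_end)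
      have M2_input: "M2 (Suc 0) = m" "M2 2 = \<Delta>"
        using xs_header by (simp_all add: M2 table_mem_def)
      \<comment> \<open>The memory left by the reading phase becomes the reference memory of the
        later phases.\<close>
      interpret dp: dp_machine m \<Delta> T ?N act M2
        by unfold_locales (use \<Delta> m_pos xs_header M2_input M2_act in auto)
      \<comment> \<open>Such an address lies in a row \<open>Suc (Suc k)\<close> with
        \<open>k \<ge> m\<close>, the activity row of an edge that never occurs.\<close>
      have zero: "M2 a = 0" if "dp.base \<le> a" for a
      proof -
        have "(2 + m) * Suc T \<le> a - ?N"
          using that unfolding dp.base_def by linarith
        then have "2 + m \<le> (a - ?N) div Suc T"
          by (simp add: less_eq_div_iff_mult_less_eq del: mult_Suc mult_Suc_right)
        then obtain k where k: "(a - ?N) div Suc T = Suc (Suc k)" "m \<le> k"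
          by (metis add_2_eq_Suc le_Suc_ex add.assoc le_add1)
        have "(a - ?N) mod Suc T \<le> T"
          using mod_less_divisor[of "Suc T" "a - ?N"] by linarith
        then show ?thesis
          using that G k unfolding M2 table_mem_def dp.base_def table_inv_def
          by (simp add: seen_end del: mult_Suc mult_Suc_right)
      qed
      show ?thesis
      proof (rule runs_Seq[OF runs_powers_prog])
        show "M2 2 = \<Delta>" "R2 rT = T"
          using M2_input 2 by simp_all
        fix R3 M3 assume 3: "(\<forall>r<13. R3 r = R2 r) \<and> M3 = M2 \<and>
          R3 rP = 2 ^ \<Delta> \<and> R3 rQ = 2 ^ T \<and> R3 rInf = 2 ^ T * 2 ^ T"
        have st: "dp.static R3 M3"
          using 2 3 unfolding dp.static_def by simp
        show "runs (dp_prog ;; pick_prog ;; decode_prog) R3 M3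
          (270 * (T * (2 ^ \<Delta> * (m * \<Delta>))) + ((30 * 2 ^ \<Delta> + 20 * T + 30) + (50 * T + 30))) Post"
        proof (rule runs_Seq[OF dp.runs_dp_prog[OF st]])
          show "R3 rRow = dp.base"
            using 2 3 by (simp add: dp.base_def)
          show "M3 a = 0" if "dp.base \<le> a" for a
            using zero[OF that] 3 by simp
          fix R4 M4 assume 4: "dp.static R4 M4 \<and> dp.base \<le> R4 rOld \<and>
            (\<forall>B<2 ^ \<Delta>. M4 (R4 rOld + B) = dp_row m act \<Delta> T T B)"
          show "runs (pick_prog ;; decode_prog) R4 M4 ((30 * 2 ^ \<Delta> + 20 * T + 30) + (50 * T + 30)) Post"
          proof (rule runs_Seq[OF dp.runs_pick_prog])
            show "dp.static R4 M4"
              using 4 by simp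
            show "M4 (R4 rOld + B) = dp_row m act \<Delta> T T B" if "B < 2 ^ \<Delta>" for B
              using 4 that by simp
            fix R5 M5 assume "M5 = M4 \<and> (\<forall>r<19. R5 r = R4 r) \<and>
              (\<exists>X. good_times m act \<Delta> T X \<and>
                (\<forall>Y. good_times m act \<Delta> T Y \<longrightarrow> card X \<le> card Y) \<and> R5 rX = time_code X)"
            then obtain X where X: "good_times m act \<Delta> T X"
                "\<And>Y. good_times m act \<Delta> T Y \<Longrightarrow> card X \<le> card Y" "R5 rX = time_code X"
              and 5: "M5 = M4" "\<forall>r<19. R5 r = R4 r"
              by blast
            have XT: "X \<subseteq> {1..T}"
              using X(1) by (simp add: good_times_def)
            have st5: "dp.static R5 M5"
              by (rule dp.static_cong[OF conjunct1[OF 4]]) (use 5 in simp_all)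
            have base5: "dp.base \<le> R5 rOld"
              using 4 5 by simp
            have G0: "M2 (?N + t) = G 0 t" if "t \<le> T" for t
              using table_mem_cell[OF that, of G 0] by (simp add: M2)
            define ps where "ps = map (\<lambda>t. (M2 (?N + t) - 1, t)) (filter (\<lambda>t. t \<in> X) (rev [1..<Suc T]))"
            have "{t. (1 \<le> t \<and> t < Suc T) \<and> t \<in> X} = X"
              using XT by auto
            then have "set ps = (\<lambda>t. (M2 (?N + t) - 1, t)) ` X"
              by (simp add: ps_def del: upt_Suc)
            moreover have "distinct ps"
              by (simp add: ps_def distinct_map inj_on_def del: upt_Suc)
            ultimately have enc: "encodes_appearances ((\<lambda>t. (M2 (?N + t) - 1, t)) ` X)
                (concat (map (\<lambda>(v, t). [v, t]) ps))"
              unfolding encodes_appearances_def by blast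
            have min: "minimum_sliding_window_tvc {..<n} E lam \<Delta> ((\<lambda>t. (M2 (?N + t) - 1, t)) ` X)"
            proof (rule minimum_sliding_window_tvcI[OF \<Delta> _ E_eq])
              fix t assume t: "t \<in> {1..T}"
              then show "M2 (?N + t) - 1 \<in> {..<n} \<and> (\<forall>e\<in>snapshot E lam t. M2 (?N + t) - 1 \<in> e)"
                using table_centre[OF G t] G0[of t] by simp
            qed (use X in \<open>simp_all add: act_def\<close>)
            show "runs decode_prog R5 M5 (50 * T + 30) Post"
            proof (rule runs_conseq[OF dp.runs_decode_prog[OF st5 base5 XT X(3)]])
              fix R6 M6 assume "output_word (R6, M6) = concat (map (\<lambda>(v, t). [v, t])
                (map (\<lambda>t. (M2 (?N + t) - 1, t)) (filter (\<lambda>t. t \<in> X) (rev [1..<Suc T]))))"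
              then have "output_word (R6, M6) = concat (map (\<lambda>(v, t). [v, t]) ps)"
                by (simp only: ps_def)
              then show "Post R6 M6"
                using enc min unfolding Post_def by auto
            qed simp
          qed simp
        qed simp
      qed simp
    qed
    show "runs ((table_init ;; scan_prog table_body table_post) ;; ?rest2) R1 M1
      ((m * (T * 120 + 140) + 50) + ((10 * \<Delta> + 20 * T + 30) +
     (270 * (T * (2 ^ \<Delta> * (m * \<Delta>))) + ((30 * 2 ^ \<Delta> + 20 * T + 30) + (50 * T + 30))))) Post"
      by (rule runs_Seq[OF table rest]) simp_all
  qed simp_all
  then obtain k R M where "exec cover_prog (\<lambda>_. 0, ?M) k (R, M)"
      "k \<le> 2000 * (T * \<Delta> * (n + m) * 2 ^ \<Delta>)" "Post R M"
    unfolding runs_def by blast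
  then show ?thesis
    unfolding Post_def computes_in_def initial_state_def card_E by blast
qed

end

theorem theorem9:
  "\<exists>(p :: com) (C :: nat).
     \<forall>(n :: nat) (E :: nat set set) (lam :: nat set \<Rightarrow> nat set) (\<Delta> :: nat) (xs :: nat list).
       always_star {..<n} E lam \<longrightarrow> 1 \<le> \<Delta> \<longrightarrow> \<Delta> \<le> lifetime E lam \<longrightarrow>
       encodes_instance n E lam \<Delta> xs \<longrightarrow>
       (\<exists>S ys k.
          computes_in p xs ys k \<and>
          encodes_appearances S ys \<and>
          minimum_sliding_window_tvc {..<n} E lam \<Delta> S \<and>
          k \<le> C * (lifetime E lam * \<Delta> * (n + card E) * 2 ^ \<Delta>))"
proof (intro exI[of _ cover_prog] exI[of _ 2000] allI impI)
  fix n :: nat and E :: "nat set set" and lam :: "nat set \<Rightarrow> nat set" and \<Delta> :: nat and xs :: "nat list"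
  assume "always_star {..<n} E lam" "1 \<le> \<Delta>" "\<Delta> \<le> lifetime E lam" "encodes_instance n E lam \<Delta> xs"
  then obtain es where "star_instance n \<Delta> es xs E lam"
    unfolding encodes_instance_def star_instance_def star_instance_axioms_def scan_input_def by blast
  then interpret star_instance n \<Delta> es xs E lam .
  show "\<exists>S ys k. computes_in cover_prog xs ys k \<and> encodes_appearances S ys \<and>
      minimum_sliding_window_tvc {..<n} E lam \<Delta> S \<and>
      k \<le> 2000 * (lifetime E lam * \<Delta> * (n + card E) * 2 ^ \<Delta>)"
    by (rule cover_prog_correct)
qed

end
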